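(* Let $p\ge q\ge1$ and $n=p+q$. Let $\mathcal{I}_{p,q}$ be the set of all Iwasawa–Schubert varieties $S_w$ in the manifold $Z$ of complete flags in $\mathbb{C}^n$ which intersect at least one open $SU(p,q)$-orbit and are parametrized by an element $w$ of length $pq$. The cardinality of $\mathcal{I}_{p,q}$ equals $$m_q=(n-1)(n-3)\cdots(n-2q+1).$$
   Context: $G=SL(n,\mathbb{C})$; $SU(p,q)$ is the isometry group (of determinant 1) of $h(v,w)=-\sum_{i=1}^qv_i\bar w_i+\sum_{i=1}^pv_{q+i}\bar w_{q+i}$. Let $(u_1,\dots,u_n)=(e_1+e_{2q},\dots,e_q+e_{q+1},e_{2q+1},\dots,e_n,e_q-e_{q+1},\dots,e_1-e_{2q})$ and let $B_I\subset G$ be the (Iwasawa–)Borel subgroup stabilizing the complete flag of this ordered basis. For $w\in\Sigma_n$, the Iwasawa–Schubert variety $S_w$ is the closure of the $B_I$-orbit of the complete flag with $k$-th subspace $\langle u_{w(1)},\dots,u_{w(k)}\rangle$; the length of $w$ is its number of inversions, which equals $\dim S_w$. *)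

theory Defs
  imports "HOL-Analysis.Analysis" "HOL-Combinatorics.Permutations"
begin

section \<open>Complete flags and the action of the special linear group\<close>

definition SLn :: "(complex^'n^'n) set" where
  "SLn = {A. det A = 1}"

text \<open>A complete flag is the sequence of its subspaces, indexed by all natural numbers. The
  dimension condition forces \<open>F k = UNIV\<close> for \<open>k \<ge> CARD('n)\<close>, so that two flags are equal as
  functions if and only if their subspaces of dimensions \<open>0, \<dots>, CARD('n)\<close> agree.\<close>

definition complete_flags :: "(nat \<Rightarrow> (complex^'n) set) set" where
  "complete_flags = {F. \<forall>k. vec.subspace (F k) \<and> vec.dim (F k) = min k CARD('n)
                          \<and> F k \<subseteq> F (Suc k)}"

definition flag_of_basis :: "(nat \<Rightarrow> complex^'n) \<Rightarrow> nat \<Rightarrow> (complex^'n) set" where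
  "flag_of_basis v = (\<lambda>k. vec.span (v ` {1..k}))"

definition act :: "complex^'n^'n \<Rightarrow> (nat \<Rightarrow> (complex^'n) set) \<Rightarrow> nat \<Rightarrow> (complex^'n) set" where
  "act g F = (\<lambda>k. (\<lambda>x. g *v x) ` F k)"

definition orbit_of ::
  "(complex^'n^'n) set \<Rightarrow> (nat \<Rightarrow> (complex^'n) set) \<Rightarrow> (nat \<Rightarrow> (complex^'n) set) set" where
  "orbit_of H F = {act g F | g. g \<in> H}"

text \<open>The manifold topology on the flags is the quotient topology of \<open>G/B\<close>, where \<open>B\<close> is the
  stabilizer of a flag. The action of \<open>SLn\<close> is transitive, so all base flags \<open>F\<close> induce the same
  topology; quantifying over \<open>F\<close> avoids the choice of one.\<close>

definition flag_topology :: "(nat \<Rightarrow> (complex^'n) set) topology" where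
  "flag_topology = topology (\<lambda>U. U \<subseteq> complete_flags \<and>
     (\<forall>F\<in>complete_flags. openin (top_of_set SLn) {g \<in> SLn. act g F \<in> U}))"

lemma act_complete_flags:
  fixes g :: "complex^'n^'n"
  assumes "g \<in> SLn" "F \<in> complete_flags"
  shows "act g F \<in> complete_flags"
proof -
  have lin: "Vector_Spaces.linear (*s) (*s) (\<lambda>x. g *v x)"
    by (rule matrix_vector_mul_linear_gen)
  have "invertible g"
    using assms(1) by (simp add: SLn_def invertible_det_nz)
  then have inj: "inj (\<lambda>x. g *v x)"
    by (metis inj_matrix_vector_mult)
  have "vec.dim ((\<lambda>x. g *v x) ` S) = vec.dim S" for S
    by (rule vec.dim_image_eq[OF lin]) (use inj in \<open>auto intro: inj_on_subset\<close>)
  then show ?thesis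
    using assms(2) vec.linear_subspace_image[OF lin]
    by (auto simp: complete_flags_def act_def)
qed

lemma openin_flag_topology:
  fixes U :: "(nat \<Rightarrow> (complex^'n) set) set"
  shows "openin flag_topology U \<longleftrightarrow> U \<subseteq> complete_flags \<and>
     (\<forall>F\<in>complete_flags. openin (top_of_set SLn) {g \<in> SLn. act g F \<in> U})"
proof -
  let ?P = "\<lambda>U::(nat \<Rightarrow> (complex^'n) set) set. U \<subseteq> complete_flags \<and>
     (\<forall>F\<in>complete_flags. openin (top_of_set SLn) {g \<in> SLn. act g F \<in> U})"
  have "istopology ?P"
    unfolding istopology_def
  proof (rule conjI; (rule allI | rule impI)+)
    fix S T assume *: "?P S" "?P T"
    have "{g \<in> SLn. act g F \<in> S \<inter> T} = {g \<in> SLn. act g F \<in> S} \<inter> {g \<in> SLn. act g F \<in> T}"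
      for F by auto
    with * show "S \<inter> T \<subseteq> complete_flags \<and>
      (\<forall>F\<in>complete_flags. openin (top_of_set SLn) {g \<in> SLn. act g F \<in> S \<inter> T})"
      by (auto intro: openin_Int)
  next
    fix \<K> assume *: "\<forall>K\<in>\<K>. ?P K"
    have "{g \<in> SLn. act g F \<in> \<Union>\<K>} = (\<Union>K\<in>\<K>. {g \<in> SLn. act g F \<in> K})" for F
      by auto
    with * show "\<Union>\<K> \<subseteq> complete_flags \<and>
      (\<forall>F\<in>complete_flags. openin (top_of_set SLn) {g \<in> SLn. act g F \<in> \<Union>\<K>})"
      by (auto intro!: openin_Union)
  qed
  then show ?thesis
    by (simp add: flag_topology_def)
qed

lemma topspace_flag_topology:
  "topspace flag_topology = (complete_flags :: (nat \<Rightarrow> (complex^'n) set) set)"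
proof -
  have "{g \<in> SLn. act g F \<in> complete_flags} = SLn" if "F \<in> complete_flags"
    for F :: "nat \<Rightarrow> (complex^'n) set"
    using that by (auto simp: act_complete_flags)
  then have "openin flag_topology (complete_flags :: (nat \<Rightarrow> (complex^'n) set) set)"
    by (simp add: openin_flag_topology)
  then show ?thesis
    by (metis openin_flag_topology openin_subset openin_topspace subset_antisym)
qed


section \<open>The group $SU(p,q)$ and its open orbits\<close>

text \<open>The numbering \<open>idx\<close> of the index type by \<open>{1..CARD('n)}\<close> orders the standard basis.\<close>

definition std_basis :: "(nat \<Rightarrow> 'n) \<Rightarrow> nat \<Rightarrow> complex^'n" where
  "std_basis idx i = axis (idx i) 1"

definition herm_form ::
  "nat \<Rightarrow> nat \<Rightarrow> (nat \<Rightarrow> 'n) \<Rightarrow> complex^'n \<Rightarrow> complex^'n \<Rightarrow> complex" where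
  "herm_form p q idx v w =
     - (\<Sum>i=1..q. v $ idx i * cnj (w $ idx i)) + (\<Sum>i=1..p. v $ idx (q + i) * cnj (w $ idx (q + i)))"

definition SUpq :: "nat \<Rightarrow> nat \<Rightarrow> (nat \<Rightarrow> 'n) \<Rightarrow> (complex^'n^'n) set" where
  "SUpq p q idx =
     {g \<in> SLn. \<forall>v w. herm_form p q idx (g *v v) (g *v w) = herm_form p q idx v w}"

definition open_SUpq_orbits ::
  "nat \<Rightarrow> nat \<Rightarrow> (nat \<Rightarrow> 'n) \<Rightarrow> (nat \<Rightarrow> (complex^'n) set) set set" where
  "open_SUpq_orbits p q idx =
     {D. (\<exists>F\<in>complete_flags. D = orbit_of (SUpq p q idx) F) \<and> openin flag_topology D}"


section \<open>Iwasawa--Schubert varieties\<close>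

definition iwasawa_basis :: "nat \<Rightarrow> nat \<Rightarrow> (nat \<Rightarrow> 'n) \<Rightarrow> nat \<Rightarrow> complex^'n" where
  "iwasawa_basis p q idx i =
     (if i \<le> q then std_basis idx i + std_basis idx (2 * q + 1 - i)
      else if i \<le> p then std_basis idx (q + i)
      else let j = p + q + 1 - i in std_basis idx j - std_basis idx (2 * q + 1 - j))"

lemma flag_of_iwasawa_basis:
  fixes idx :: "nat \<Rightarrow> 'n::finite"
  assumes "p \<ge> q" "CARD('n) = p + q" "bij_betw idx {1..p + q} UNIV" "w permutes {1..p + q}"
  shows "flag_of_basis (iwasawa_basis p q idx \<circ> w) \<in> complete_flags"
proof -
  let ?n = "p + q" and ?u = "iwasawa_basis p q idx" and ?e = "std_basis idx :: nat \<Rightarrow> complex^'n"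
  let ?v = "?u \<circ> w"
  let ?S = "vec.span (?u ` {1..?n})"
  have u: "?u i \<in> ?S" if "1 \<le> i" "i \<le> ?n" for i
    using that by (intro vec.span_base) auto
  have e: "?e j \<in> ?S" if j: "1 \<le> j" "j \<le> ?n" for j
  proof -
    have half: "x \<in> ?S" if "x + x \<in> ?S" for x
    proof -
      have "(1/2) *s (x + x) \<in> ?S" using that by (rule vec.span_scale)
      moreover have "(1/2) *s (x + x) = x" by (simp add: vec_eq_iff)
      ultimately show ?thesis by simp
    qed
    have lo: "?e i + ?e (2 * q + 1 - i) \<in> ?S" "?e i - ?e (2 * q + 1 - i) \<in> ?S"
      if "1 \<le> i" "i \<le> q" for i
    proof -
      show "?e i + ?e (2 * q + 1 - i) \<in> ?S"
        using u[of i] that by (simp add: iwasawa_basis_def[of _ _ _ i])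
      have "?u (?n + 1 - i) = ?e i - ?e (2 * q + 1 - i)"
      proof -
        have "\<not> ?n + 1 - i \<le> q" "\<not> ?n + 1 - i \<le> p" "?n + 1 - (?n + 1 - i) = i"
          using that assms(1) by linarith+
        then show ?thesis by (simp only: iwasawa_basis_def Let_def if_False)
      qed
      then show "?e i - ?e (2 * q + 1 - i) \<in> ?S"
        using u[of "?n + 1 - i"] that by simp
    qed
    consider "j \<le> q" | "q < j" "j \<le> 2 * q" | "2 * q < j" by linarith
    then show ?thesis
    proof cases
      case 1
      show ?thesis
        using vec.span_add[OF lo[OF j(1) 1]] by - (rule half, simp)
    next
      case 2
      then have i: "1 \<le> 2 * q + 1 - j" "2 * q + 1 - j \<le> q" "2 * q + 1 - (2 * q + 1 - j) = j"
        by auto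
      show ?thesis
        using vec.span_diff[OF lo[OF i(1,2)]] i(3) by - (rule half, simp)
    next
      case 3
      then have "?u (j - q) = ?e j" using j assms(1) by (auto simp: iwasawa_basis_def Let_def)
      then show ?thesis using u[of "j - q"] 3 j by simp
    qed
  qed
  have "axis i 1 \<in> ?S" for i :: 'n
  proof -
    obtain j where "j \<in> {1..?n}" "i = idx j"
      using bij_betw_imp_surj_on[OF assms(3)] by blast
    then show ?thesis using e[of j] by (simp only: std_basis_def atLeastAtMost_iff)
  qed
  then have "cart_basis \<subseteq> ?S" by (auto simp: cart_basis_def)
  then have "vec.span cart_basis \<subseteq> ?S" by (rule vec.span_minimal) (rule vec.subspace_span)
  then have span: "?S = UNIV" by (simp only: span_cart_basis top.extremum_unique)
  have img: "?v ` {1..?n} = ?u ` {1..?n}"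
    by (simp only: image_comp[symmetric] permutes_image[OF assms(4)])
  have dimU: "vec.dim (UNIV :: (complex^'n) set) = ?n"
    using assms(2) by (simp only: vec_dim_card)
  have "?n \<le> card (?v ` {1..?n})"
  proof -
    have "vec.dim (UNIV :: (complex^'n) set) \<le> card (?v ` {1..?n})"
      by (rule vec.dim_le_card) (simp_all only: img span finite_imageI finite_atLeastAtMost top_greatest)
    then show ?thesis by (simp only: dimU)
  qed
  then have card: "card (?v ` {1..?n}) = ?n"
    using card_image_le[of "{1..?n}" ?v] by simp
  then have inj: "inj_on ?v {1..?n}"
    by (intro eq_card_imp_inj_on) auto
  have ind: "vec.independent (?v ` {1..?n})"
    by (rule vec.card_le_dim_spanning[of _ UNIV]) (simp_all only: img span dimU, use card img in auto)
  have "vec.dim (?v ` {1..k}) = min k ?n" for k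
  proof (cases "k \<le> ?n")
    case True
    then have "vec.independent (?v ` {1..k})"
      by (intro vec.independent_mono[OF ind] image_mono) auto
    moreover have "card (?v ` {1..k}) = k"
      using True by (subst card_image) (auto intro: inj_on_subset[OF inj])
    ultimately show ?thesis
      using True by (simp add: vec.dim_eq_card_independent)
  next
    case False
    then have "vec.span (?v ` {1..?n}) \<subseteq> vec.span (?v ` {1..k})"
      by (intro vec.span_mono image_mono) auto
    then have "vec.span (?v ` {1..k}) = UNIV"
      by (simp only: img span top.extremum_unique)
    then have "vec.dim (?v ` {1..k}) = ?n"
      using dimU vec.dim_span[of "?v ` {1..k}"] by simp
    then show ?thesis using False by simp
  qed
  moreover have "vec.span (?v ` {1..k}) \<subseteq> vec.span (?v ` {1..Suc k})" for k
    by (intro vec.span_mono image_mono) auto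
  ultimately show ?thesis
    unfolding complete_flags_def flag_of_basis_def assms(2)
    by (simp only: mem_Collect_eq vec.dim_span vec.subspace_span simp_thms)
qed

definition iwasawa_borel :: "nat \<Rightarrow> nat \<Rightarrow> (nat \<Rightarrow> 'n) \<Rightarrow> (complex^'n^'n) set" where
  "iwasawa_borel p q idx =
     {g \<in> SLn. act g (flag_of_basis (iwasawa_basis p q idx)) = flag_of_basis (iwasawa_basis p q idx)}"

definition iwasawa_schubert ::
  "nat \<Rightarrow> nat \<Rightarrow> (nat \<Rightarrow> 'n) \<Rightarrow> (nat \<Rightarrow> nat) \<Rightarrow> (nat \<Rightarrow> (complex^'n) set) set" where
  "iwasawa_schubert p q idx w =
     flag_topology closure_of
       orbit_of (iwasawa_borel p q idx) (flag_of_basis (iwasawa_basis p q idx \<circ> w))"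

definition perm_length :: "nat \<Rightarrow> (nat \<Rightarrow> nat) \<Rightarrow> nat" where
  "perm_length n w = card {(i, j). i \<in> {1..n} \<and> j \<in> {1..n} \<and> i < j \<and> w j < w i}"

definition I_set :: "nat \<Rightarrow> nat \<Rightarrow> (nat \<Rightarrow> 'n) \<Rightarrow> (nat \<Rightarrow> (complex^'n) set) set set" where
  "I_set p q idx =
     {iwasawa_schubert p q idx w | w.
        w permutes {1..p + q} \<and> perm_length (p + q) w = p * q \<and>
        (\<exists>D\<in>open_SUpq_orbits p q idx. iwasawa_schubert p q idx w \<inter> D \<noteq> {})}"

end

theory Submission
  imports Defs
begin

text \<open>Write \<open>b' = n + 1 - b\<close> for \<open>1 \<le> b \<le> q\<close>. In the basis \<open>u\<close> the form pairs the vector with index \<open>b\<close> only with the one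
  with index \<open>b'\<close> and is definite on the span of the remaining vectors. An orbit of \<open>SU(p,q)\<close> is open
  only if its flags consist of nondegenerate subspaces. Counting isotropic vectors, a Borel orbit \<open>w\<close> that
  contains such a flag satisfies a ballot condition: every prefix of the word \<open>w(1) \<dots> w(n)\<close> contains, for all \<open>a \<le> q\<close>,
  at least as many of the letters \<open>1', \<dots>, a'\<close> as of \<open>1, \<dots>, a\<close>.

  Counting the inversions of \<open>w\<close> pair by pair, from the outermost pair \<open>{1, n}\<close> inwards, writes the length of \<open>w\<close>
  minus \<open>p q\<close> as a sum of terms that are nonnegative under the ballot condition. So length \<open>p q\<close> forces all of them to
  vanish: \<open>b'\<close> stands before \<open>b\<close>, no letter strictly between \<open>b\<close> and \<open>b'\<close> in value stands between them in the word, and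
  the middle letters increase. In such a word the letters \<open>n\<close> and \<open>1\<close> are adjacent; deleting them leaves a word of the
  same kind, into which they can be inserted at \<open>n - 1\<close> places, whence the product. Conversely, if every \<open>b'\<close>
  stands before \<open>b\<close>, then the Borel orbit contains a flag of coordinate subspaces, whose \<open>SU(p,q)\<close>-orbit is open by
  continuity of the Gram--Schmidt process.\<close>

section \<open>Nested words\<close>

primrec precedes :: "'a list \<Rightarrow> 'a \<Rightarrow> 'a \<Rightarrow> bool" where
  "precedes [] s t \<longleftrightarrow> False"
| "precedes (x # xs) s t \<longleftrightarrow> (x = s \<and> t \<in> set xs) \<or> precedes xs s t"

lemma precedes_append:
  "precedes (xs @ ys) s t \<longleftrightarrow> precedes xs s t \<or> precedes ys s t \<or> (s \<in> set xs \<and> t \<in> set ys)"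
  by (induction xs) auto

lemma precedes_in_set: "precedes xs s t \<Longrightarrow> s \<in> set xs \<and> t \<in> set xs"
  by (induction xs) auto

lemma precedes_split: "precedes xs s t \<Longrightarrow> \<exists>A C B. xs = A @ s # C @ t # B"
proof (induction xs)
  case (Cons x xs)
  show ?case
  proof (cases "x = s \<and> t \<in> set xs")
    case True
    then show ?thesis by (metis append_Nil split_list)
  next
    case False
    then show ?thesis using Cons by (metis append_Cons precedes.simps(2))
  qed
qed simp

lemma precedes_insert:
  assumes "s \<notin> {x, y}" "t \<notin> {x, y}"
  shows "precedes (A @ [x, y] @ B) s t \<longleftrightarrow> precedes (A @ B) s t"
  using assms by (auto simp: precedes_append)

lemma precedes_map_upt:
  "precedes (map w [a..<b]) s t \<longleftrightarrow> (\<exists>i j. a \<le> i \<and> i < j \<and> j < b \<and> w i = s \<and> w j = t)"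
proof (induction b)
  case (Suc b)
  show ?case
  proof (cases "a \<le> b")
    case True
    have "precedes (map w [a..<Suc b]) s t \<longleftrightarrow>
      (\<exists>i j. a \<le> i \<and> i < j \<and> j < b \<and> w i = s \<and> w j = t) \<or> (\<exists>i. a \<le> i \<and> i < b \<and> w i = s \<and> w b = t)"
      using True Suc by (auto simp: precedes_append)
    also have "\<dots> \<longleftrightarrow> (\<exists>i j. a \<le> i \<and> i < j \<and> j < Suc b \<and> w i = s \<and> w j = t)"
      by (auto simp: less_Suc_eq)
    finally show ?thesis .
  qed auto
qed simp

text \<open>The parameter \<open>d\<close> counts the outermost pairs of letters already deleted,
  which makes the family recursive; \<open>d = 0\<close> gives the words of the permutations to be
  counted.\<close>

definition nested_words :: "nat \<Rightarrow> nat \<Rightarrow> nat \<Rightarrow> nat list set" where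
  "nested_words n q d = {xs. distinct xs \<and> set xs = {d<..n - d} \<and>
     (\<forall>b\<in>{d<..q}. precedes xs (n + 1 - b) b \<and>
        (\<forall>t. b < t \<and> t < n + 1 - b \<longrightarrow> \<not> (precedes xs (n + 1 - b) t \<and> precedes xs t b))) \<and>
     (\<forall>s t. q < s \<and> s < t \<and> t \<le> n - q \<longrightarrow> precedes xs s t)}"

text \<open>Nothing stands between the two adjacent new letters, and both lie outside every interval
  from \<open>b\<close> to \<open>n + 1 - b\<close> with \<open>b > Suc d\<close>, so the conditions
  on the inner pairs are not affected.\<close>

lemma nested_words_insert:
  assumes "d < q" "2 * q \<le> n" and ys: "A @ B \<in> nested_words n q (Suc d)"
  shows "A @ [n - d, Suc d] @ B \<in> nested_words n q d"
proof -
  let ?xs = "A @ [n - d, Suc d] @ B"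
  from ys have dist: "distinct (A @ B)" and set: "set (A @ B) = {Suc d<..n - Suc d}"
    by (auto simp: nested_words_def)
  have nin: "n - d \<notin> set (A @ B)" "Suc d \<notin> set (A @ B)" and neq: "n - d \<noteq> Suc d"
    using assms(1,2) unfolding set by auto
  have "set ?xs = {d<..n - d}"
  proof -
    have "set ?xs = insert (n - d) (insert (Suc d) (set (A @ B)))" by auto
    also have "\<dots> = {d<..n - d}" using assms(1,2) unfolding set by auto
    finally show ?thesis .
  qed
  moreover have "distinct ?xs" using dist nin neq by auto
  moreover have "precedes ?xs (n + 1 - b) b \<and>
        (\<forall>t. b < t \<and> t < n + 1 - b \<longrightarrow> \<not> (precedes ?xs (n + 1 - b) t \<and> precedes ?xs t b))"
    if b: "b \<in> {d<..q}" for b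
  proof (cases "b = Suc d")
    case True
    have "\<not> (precedes ?xs (n - d) t \<and> precedes ?xs t (Suc d))" if "Suc d < t" "t < n - d" for t
      using nin neq dist that
      by (auto simp: precedes_append dest: precedes_in_set)
    moreover have "precedes ?xs (n - d) (Suc d)" by (auto simp: precedes_append)
    ultimately show ?thesis using True by simp
  next
    case False
    then have b': "b \<in> {Suc d<..q}" using b by auto
    define xs where "xs = ?xs"
    define ys where "ys = A @ B"
    have eq: "precedes xs s t \<longleftrightarrow> precedes ys s t" if "b \<le> s" "s \<le> n + 1 - b" "b \<le> t" "t \<le> n + 1 - b" for s t
      unfolding xs_def ys_def by (rule precedes_insert) (use that b' assms(1,2) in auto)
    have "ys \<in> nested_words n q (Suc d)" using ys by (simp add: ys_def)
    then have "precedes xs (n + 1 - b) b \<and>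
        (\<forall>t. b < t \<and> t < n + 1 - b \<longrightarrow> \<not> (precedes xs (n + 1 - b) t \<and> precedes xs t b))"
      using b' assms(1,2) by (auto simp: nested_words_def eq)
    then show ?thesis unfolding xs_def .
  qed
  moreover have "precedes ?xs s t" if "q < s \<and> s < t \<and> t \<le> n - q" for s t
  proof -
    have "precedes ?xs s t \<longleftrightarrow> precedes (A @ B) s t"
      by (rule precedes_insert) (use that assms(1,2) in auto)
    then show ?thesis using ys that by (auto simp: nested_words_def)
  qed
  ultimately show ?thesis unfolding nested_words_def by blast
qed

text \<open>Every letter other than \<open>n - d\<close> and \<open>Suc d\<close> lies strictly
  between them in value, hence may not stand between them in the word. The two are therefore
  adjacent.\<close>

lemma nested_words_remove:
  assumes "d < q" "2 * q \<le> n" and xs: "xs \<in> nested_words n q d"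
  obtains A B where "xs = A @ [n - d, Suc d] @ B" "A @ B \<in> nested_words n q (Suc d)"
proof -
  have dist: "distinct xs" and set: "set xs = {d<..n - d}"
    and b: "\<And>b. b \<in> {d<..q} \<Longrightarrow> precedes xs (n + 1 - b) b \<and>
        (\<forall>t. b < t \<and> t < n + 1 - b \<longrightarrow> \<not> (precedes xs (n + 1 - b) t \<and> precedes xs t b))"
    and mid: "\<And>s t. q < s \<Longrightarrow> s < t \<Longrightarrow> t \<le> n - q \<Longrightarrow> precedes xs s t"
    using xs by (auto simp: nested_words_def)
  have "precedes xs (n - d) (Suc d)" using b[of "Suc d"] assms(1) by simp
  then obtain A C B where ACB: "xs = A @ (n - d) # C @ Suc d # B" using precedes_split by metis
  have "C = []"
  proof (rule ccontr)
    assume "C \<noteq> []"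
    then obtain t where t: "t \<in> set C" by (cases C) auto
    then have "t \<in> {d<..n - d}" "t \<noteq> n - d" "t \<noteq> Suc d"
      using set dist unfolding ACB by auto
    then have "Suc d < t" "t < n + 1 - Suc d" using assms(1,2) by auto
    moreover have "precedes xs (n - d) t" "precedes xs t (Suc d)"
      using t unfolding ACB by (auto simp: precedes_append)
    ultimately show False using b[of "Suc d"] assms(1) by auto
  qed
  then have xs_eq: "xs = A @ [n - d, Suc d] @ B" using ACB by simp
  have "set (A @ B) = set xs - {n - d, Suc d}" using dist unfolding xs_eq by auto
  also have "\<dots> = {Suc d<..n - Suc d}" using assms(1,2) unfolding set by auto
  finally have set': "set (A @ B) = {Suc d<..n - Suc d}" .
  have eq: "precedes xs s t \<longleftrightarrow> precedes (A @ B) s t"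
    if "Suc d < s" "s < n - d" "Suc d < t" "t < n - d" for s t
    unfolding xs_eq by (rule precedes_insert) (use that in auto)
  have "precedes (A @ B) (n + 1 - c) c \<and>
        (\<forall>t. c < t \<and> t < n + 1 - c \<longrightarrow> \<not> (precedes (A @ B) (n + 1 - c) t \<and> precedes (A @ B) t c))"
    if "c \<in> {Suc d<..q}" for c
    using b[of c] that assms(1,2) by (auto simp: eq)
  moreover have "precedes (A @ B) s t" if "q < s \<and> s < t \<and> t \<le> n - q" for s t
  proof -
    have "precedes xs s t \<longleftrightarrow> precedes (A @ B) s t" by (rule eq) (use that assms(1,2) in auto)
    then show ?thesis using mid that by auto
  qed
  moreover have "distinct (A @ B)" using dist unfolding xs_eq by auto
  ultimately have "A @ B \<in> nested_words n q (Suc d)" using set' unfolding nested_words_def by blast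
  with xs_eq show thesis by (rule that)
qed

text \<open>A word of the smaller kind has \<open>n - 2 * Suc d\<close> letters and thus one more
  place for the adjacent pair; insertion is bijective.\<close>

lemma nested_words_Suc:
  assumes "d < q" "2 * q \<le> n"
  shows "card (nested_words n q d) = (n + 1 - 2 * Suc d) * card (nested_words n q (Suc d))"
proof -
  let ?ins = "\<lambda>(ys, i). take i ys @ [n - d, Suc d] @ drop i ys"
  let ?X = "nested_words n q (Suc d) \<times> {..<n + 1 - 2 * Suc d}"
  have len: "length ys = n - 2 * Suc d" and notin: "n - d \<notin> set ys"
    if "ys \<in> nested_words n q (Suc d)" for ys
  proof -
    have "length ys = card {Suc d<..n - Suc d}"
      using that by (simp add: nested_words_def flip: distinct_card)
    then show "length ys = n - 2 * Suc d" by simp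
    show "n - d \<notin> set ys" using that assms by (auto simp: nested_words_def)
  qed
  have "inj_on ?ins ?X"
  proof (rule inj_onI)
    fix y z assume yz: "y \<in> ?X" "z \<in> ?X" "?ins y = ?ins z"
    obtain ys i zs j where [simp]: "y = (ys, i)" "z = (zs, j)" by (cases y, cases z)
    have ys: "ys \<in> nested_words n q (Suc d)" and zs: "zs \<in> nested_words n q (Suc d)"
      and i: "i \<in> {..<n + 1 - 2 * Suc d}" and j: "j \<in> {..<n + 1 - 2 * Suc d}"
      and eq: "take i ys @ [n - d, Suc d] @ drop i ys = take j zs @ [n - d, Suc d] @ drop j zs"
      using yz by simp_all
    \<comment> \<open>The letter \<open>n - d\<close> is new, so cutting the word at it recovers the
      prefix. The length of the prefix then recovers the place \<open>i\<close>, which is at most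
      the length of \<open>ys\<close>.\<close>
    have "n - d \<notin> set (take i ys)" "n - d \<notin> set (take j zs)"
      using notin[OF ys] notin[OF zs] by (auto dest: in_set_takeD)
    moreover have "takeWhile (\<lambda>x. x \<noteq> n - d) (take i ys @ [n - d, Suc d] @ drop i ys)
       = takeWhile (\<lambda>x. x \<noteq> n - d) (take j zs @ [n - d, Suc d] @ drop j zs)"
      by (simp only: eq)
    ultimately have t: "take i ys = take j zs" by (auto simp: takeWhile_append split: if_splits)
    then have "drop i ys = drop j zs" using eq by simp
    then have "ys = zs" using t by (metis append_take_drop_id)
    moreover have "i = j" using arg_cong[OF t, of length] len[OF ys] len[OF zs] i j by auto
    ultimately show "y = z" by simp
  qed
  moreover have "nested_words n q d = ?ins ` ?X"
  proof (intro equalityI subsetI)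
    fix xs assume "xs \<in> nested_words n q d"
    then obtain A B where AB: "xs = A @ [n - d, Suc d] @ B" "A @ B \<in> nested_words n q (Suc d)"
      using nested_words_remove[OF assms] by metis
    have "length A < n + 1 - 2 * Suc d" using len[OF AB(2)] assms by simp
    then have "(A @ B, length A) \<in> ?X" "xs = ?ins (A @ B, length A)" using AB by auto
    then show "xs \<in> ?ins ` ?X" by blast
  next
    fix xs assume "xs \<in> ?ins ` ?X"
    then obtain ys i where "ys \<in> nested_words n q (Suc d)" "xs = take i ys @ [n - d, Suc d] @ drop i ys"
      by auto
    then show "xs \<in> nested_words n q d"
      using nested_words_insert[OF assms, of "take i ys" "drop i ys"] by simp
  qed
  ultimately show ?thesis by (simp add: card_image card_cartesian_product mult.commute)
qed

text \<open>Without pairs only the middle letters remain, in increasing order; for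
  \<open>n = 2 * q\<close> this is the empty word.\<close>

lemma nested_words_base:
  assumes "2 * q \<le> n"
  shows "nested_words n q q = {[Suc q..<Suc (n - q)]}"
proof -
  have *: "sorted_wrt (<) xs" if "\<And>s t. s \<in> set xs \<Longrightarrow> t \<in> set xs \<Longrightarrow> s < t \<Longrightarrow> precedes xs s t" "distinct xs"
    for xs :: "nat list"
    using that
  proof (induction xs)
    case (Cons x xs)
    have "x < y" if "y \<in> set xs" for y
    proof (rule ccontr)
      assume "\<not> x < y"
      then have "y < x" using that Cons.prems(2) by (metis distinct.simps(2) nat_neq_iff)
      then show False using Cons.prems(1)[of y x] Cons.prems(2) that by (auto dest: precedes_in_set)
    qed
    moreover have "precedes xs s t" if "s \<in> set xs" "t \<in> set xs" "s < t" for s t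
      using Cons.prems(1)[of s t] Cons.prems(2) that by auto
    ultimately show ?case using Cons by auto
  qed simp
  have "xs = [Suc q..<Suc (n - q)]" if "xs \<in> nested_words n q q" for xs
  proof (rule strict_sorted_equal)
    show "sorted_wrt (<) xs" by (rule *) (use that in \<open>auto simp: nested_words_def\<close>)
    show "set xs = set [Suc q..<Suc (n - q)]" using that by (auto simp: nested_words_def)
  qed (simp del: upt_Suc)
  moreover have "precedes [Suc q..<Suc (n - q)] s t" if "q < s" "s < t" "t \<le> n - q" for s t
    using precedes_map_upt[of "\<lambda>x. x" "Suc q" "Suc (n - q)" s t] that by auto
  then have "[Suc q..<Suc (n - q)] \<in> nested_words n q q"
    by (auto simp: nested_words_def)
  ultimately show ?thesis by blast
qed

lemma card_nested_words:
  assumes "d \<le> q" "2 * q \<le> n"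
  shows "card (nested_words n q d) = (\<Prod>i\<in>{d<..q}. n + 1 - 2 * i)"
  using assms(1)
proof (induction d rule: inc_induct)
  case base
  show ?case using nested_words_base[OF assms(2)] by simp
next
  case (step d)
  have "{d<..q} = insert (Suc d) {Suc d<..q}" using step(2) by auto
  then show ?case using nested_words_Suc[OF step(2) assms(2)] step(3) by simp
qed

section \<open>Permutations with nested words\<close>

text \<open>In the word of \<open>w\<close> the letter \<open>t\<close> stands at position
  \<open>inv w t\<close>, so these are the order conditions of \<open>nested_words\<close> for
  \<open>d = 0\<close>.\<close>

definition nested_perm :: "nat \<Rightarrow> nat \<Rightarrow> (nat \<Rightarrow> nat) \<Rightarrow> bool" where
  "nested_perm n q w \<longleftrightarrow>
     (\<forall>b\<in>{1..q}. inv w (n + 1 - b) < inv w b \<and>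
        (\<forall>t. b < t \<and> t < n + 1 - b \<longrightarrow> \<not> (inv w (n + 1 - b) < inv w t \<and> inv w t < inv w b))) \<and>
     (\<forall>s t. q < s \<and> s < t \<and> t \<le> n - q \<longrightarrow> inv w s < inv w t)"

lemma precedes_permutation:
  assumes "w permutes {1..n}" "s \<in> {1..n}" "t \<in> {1..n}"
  shows "precedes (map w [1..<Suc n]) s t \<longleftrightarrow> inv w s < inv w t"
proof -
  have "inv w s \<in> {1..n}" "inv w t \<in> {1..n}"
    using assms permutes_in_image[OF permutes_inv[OF assms(1)]] by blast+
  then have "1 \<le> inv w s" "inv w t < Suc n" by auto
  then show ?thesis
    unfolding precedes_map_upt using permutes_inverses[OF assms(1)] by metis
qed

lemma nested_perm_iff:
  assumes "w permutes {1..n}" "2 * q \<le> n"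
  shows "nested_perm n q w \<longleftrightarrow> map w [1..<Suc n] \<in> nested_words n q 0"
proof -
  have "set (map w [1..<Suc n]) = w ` {1..n}" by auto
  also have "\<dots> = {0<..n}" using permutes_image[OF assms(1)] by auto
  finally have "set (map w [1..<Suc n]) = {0<..n}" .
  moreover have "distinct (map w [1..<Suc n])"
    using assms(1) by (simp add: distinct_map permutes_inj_on del: upt_Suc)
  moreover have "{0<..q} = {1..q}" by auto
  moreover define xs where "xs = map w [1..<Suc n]"
  moreover have eq: "precedes xs s t \<longleftrightarrow> inv w s < inv w t" if "s \<in> {1..n}" "t \<in> {1..n}" for s t
    unfolding xs_def by (rule precedes_permutation[OF assms(1) that])
  moreover have "(precedes xs (n + 1 - b) b \<and>
        (\<forall>t. b < t \<and> t < n + 1 - b \<longrightarrow> \<not> (precedes xs (n + 1 - b) t \<and> precedes xs t b)))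
     \<longleftrightarrow> (inv w (n + 1 - b) < inv w b \<and>
        (\<forall>t. b < t \<and> t < n + 1 - b \<longrightarrow> \<not> (inv w (n + 1 - b) < inv w t \<and> inv w t < inv w b)))"
    if "b \<in> {1..q}" for b
  proof -
    have "b \<in> {1..n}" "n + 1 - b \<in> {1..n}" "\<And>t. b < t \<Longrightarrow> t < n + 1 - b \<Longrightarrow> t \<in> {1..n}"
      using that assms(2) by auto
    then show ?thesis by (metis eq)
  qed
  moreover have "(\<forall>s t. q < s \<and> s < t \<and> t \<le> n - q \<longrightarrow> precedes xs s t)
     \<longleftrightarrow> (\<forall>s t. q < s \<and> s < t \<and> t \<le> n - q \<longrightarrow> inv w s < inv w t)"
  proof (intro all_cong1 imp_cong refl eq)
  qed auto
  ultimately show ?thesis unfolding nested_words_def nested_perm_def by simp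
qed

lemma card_nested_perm:
  assumes "2 * q \<le> n"
  shows "card {w. w permutes {1..n} \<and> nested_perm n q w} = (\<Prod>i=1..q. n + 1 - 2 * i)"
proof -
  let ?f = "\<lambda>w. map w [1..<Suc n]"
  have "inj_on ?f {w. w permutes {1..n}}"
  proof (rule inj_onI, clarify)
    fix v w :: "nat \<Rightarrow> nat" assume vw: "v permutes {1..n}" "w permutes {1..n}" "?f v = ?f w"
    from vw(3) have "\<forall>i\<in>set [1..<Suc n]. v i = w i" by (simp only: map_eq_conv)
    then have "v i = w i" if "i \<in> {1..n}" for i using that by (simp del: upt_Suc)
    then show "v = w"
      using permutes_not_in[OF vw(1)] permutes_not_in[OF vw(2)] by (metis ext)
  qed
  then have inj: "inj_on ?f {w. w permutes {1..n} \<and> nested_perm n q w}"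
    by (rule inj_on_subset) auto
  have "?f ` {w. w permutes {1..n} \<and> nested_perm n q w} = nested_words n q 0"
  proof (intro equalityI subsetI)
    fix xs assume "xs \<in> ?f ` {w. w permutes {1..n} \<and> nested_perm n q w}"
    then show "xs \<in> nested_words n q 0" using nested_perm_iff[OF _ assms] by blast
  next
    fix xs assume xs: "xs \<in> nested_words n q 0"
    then have dist: "distinct xs" and set: "set xs = {1..n}" by (auto simp: nested_words_def)
    have len: "length xs = n" using distinct_card[OF dist] set by simp
    \<comment> \<open>List indices start at 0, positions in the word at 1; outside
      \<open>{1..n}\<close> the identity is forced by \<open>permutes\<close>.\<close>
    define w where "w i = (if i \<in> {1..n} then xs ! (i - 1) else i)" for i
    have "inj_on w {1..n}"
      using dist len by (auto simp: inj_on_def w_def nth_eq_iff_index_eq)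
    moreover have sub: "w ` {1..n} \<subseteq> {1..n}"
    proof
      fix x assume "x \<in> w ` {1..n}"
      then obtain i where "i \<in> {1..n}" "x = xs ! (i - 1)" by (auto simp: w_def)
      then have "x \<in> set xs" using len by (auto intro!: nth_mem)
      then show "x \<in> {1..n}" using set by simp
    qed
    ultimately have "w permutes {1..n}"
      by (intro bij_imp_permutes bij_betw_imageI endo_inj_surj) (auto simp: w_def)
    moreover have "?f w = xs"
      by (rule nth_equalityI) (auto simp: len w_def simp del: upt_Suc)
    ultimately show "xs \<in> ?f ` {w. w permutes {1..n} \<and> nested_perm n q w}"
      using xs nested_perm_iff[OF _ assms, of w] by (metis (mono_tags, lifting) image_eqI mem_Collect_eq)
  qed
  then have "card {w. w permutes {1..n} \<and> nested_perm n q w} = card (nested_words n q 0)"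
    using card_image[OF inj] by simp
  also have "\<dots> = (\<Prod>i\<in>{0<..q}. n + 1 - 2 * i)" by (rule card_nested_words) (use assms in auto)
  also have "{0<..q} = {1..q}" by auto
  finally show ?thesis .
qed

section \<open>The length of a permutation under a ballot condition\<close>

text \<open>An inversion of \<open>w\<close> becomes one of \<open>inv w\<close> by exchanging
  positions and values. The ballot condition speaks of positions of letters, so the length is
  computed from \<open>inv w\<close>.\<close>

lemma perm_length_inv:
  assumes w: "w permutes {1..n}"
  shows "perm_length n w = card {(s, t). 0 < s \<and> s < t \<and> t \<le> n \<and> inv w t < inv w s}"
proof -
  let ?f = "\<lambda>(i, j). (w j, w i)"
  let ?A = "{(i, j). i \<in> {1..n} \<and> j \<in> {1..n} \<and> i < j \<and> w j < w i}"
  let ?B = "{(s, t). 0 < s \<and> s < t \<and> t \<le> n \<and> inv w t < inv w s}"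
  have in_range: "w i \<in> {1..n} \<longleftrightarrow> i \<in> {1..n}" "inv w i \<in> {1..n} \<longleftrightarrow> i \<in> {1..n}" for i
    using permutes_in_image[OF w] permutes_in_image[OF permutes_inv[OF w]] by auto
  have inv: "w (inv w i) = i" "inv w (w i) = i" for i
    using permutes_inverses[OF w] by auto
  have "bij_betw ?f ?A ?B"
  proof (rule bij_betw_byWitness[where f' = "\<lambda>(s, t). (inv w t, inv w s)"])
    show "?f ` ?A \<subseteq> ?B"
    proof clarify
      fix i j assume "i \<in> {1..n}" "j \<in> {1..n}" "i < j" "w j < w i"
      then show "0 < w j \<and> w j < w i \<and> w i \<le> n \<and> inv w (w i) < inv w (w j)"
        using in_range(1)[of i] in_range(1)[of j] by (simp add: inv)
    qed
    show "(\<lambda>(s, t). (inv w t, inv w s)) ` ?B \<subseteq> ?A"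
    proof clarify
      fix s t assume "0 < s" "s < t" "t \<le> n" "inv w t < inv w s"
      then show "inv w t \<in> {1..n} \<and> inv w s \<in> {1..n} \<and> inv w t < inv w s \<and> w (inv w s) < w (inv w t)"
        using in_range(2)[of s] in_range(2)[of t] by (simp add: inv)
    qed
  qed (auto simp: inv)
  then show ?thesis unfolding perm_length_def by (rule bij_betw_same_card)
qed

definition inversions_between :: "(nat \<Rightarrow> nat) \<Rightarrow> nat \<Rightarrow> nat \<Rightarrow> int" where
  "inversions_between P a b = (\<Sum>s\<in>{a<..b}. \<Sum>t\<in>{s<..b}. of_bool (P t < P s))"

text \<open>The pairs that contain an outermost letter are split off. A letter \<open>t\<close>
  between \<open>Suc a\<close> and \<open>b\<close> forms an inversion with \<open>b\<close> if
  \<open>P b < P t\<close>, and one with \<open>Suc a\<close> unless \<open>P (Suc a) < P t\<close>;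
  this yields the summand.\<close>

lemma inversions_between_peel:
  fixes P :: "nat \<Rightarrow> nat"
  assumes "inj_on P {a<..b}" "Suc a < b"
  shows "inversions_between P a b = of_bool (P b < P (Suc a))
     + (\<Sum>t\<in>{Suc a<..<b}. 1 + of_bool (P b < P t) - of_bool (P (Suc a) < P t))
     + inversions_between P (Suc a) (b - 1)"
proof -
  obtain c where b: "b = Suc c" and c: "Suc a \<le> c" using assms(2) by (cases b) auto
  have i1: "{a<..b} = insert (Suc a) (insert b {Suc a<..c})" using b c by auto
  have i2: "{s<..b} = insert b {s<..c}" if "s \<le> c" for s using that b by auto
  have i3: "{Suc a<..<b} = {Suc a<..c}" using b by auto
  have "inversions_between P a b = (\<Sum>t\<in>{Suc a<..b}. of_bool (P t < P (Suc a)))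
      + (\<Sum>s\<in>{Suc a<..c}. \<Sum>t\<in>{s<..b}. of_bool (P t < P s))"
    unfolding inversions_between_def i1 using b c by simp
  also have "(\<Sum>t\<in>{Suc a<..b}. of_bool (P t < P (Suc a)) :: int)
      = of_bool (P b < P (Suc a)) + (\<Sum>t\<in>{Suc a<..c}. of_bool (P t < P (Suc a)))"
    unfolding i2[OF c] using b by (subst sum.insert) auto
  also have "(\<Sum>t\<in>{Suc a<..c}. of_bool (P t < P (Suc a)) :: int) = (\<Sum>t\<in>{Suc a<..c}. 1 - of_bool (P (Suc a) < P t))"
  proof (rule sum.cong[OF refl])
    fix t assume "t \<in> {Suc a<..c}"
    then have "P t \<noteq> P (Suc a)" using assms(1) c b by (auto dest!: inj_onD)
    then show "(of_bool (P t < P (Suc a)) :: int) = 1 - of_bool (P (Suc a) < P t)" by auto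
  qed
  also have "(\<Sum>s\<in>{Suc a<..c}. \<Sum>t\<in>{s<..b}. of_bool (P t < P s) :: int)
      = (\<Sum>s\<in>{Suc a<..c}. of_bool (P b < P s)) + inversions_between P (Suc a) c"
    unfolding inversions_between_def sum.distrib[symmetric]
  proof (rule sum.cong[OF refl])
    fix s assume "s \<in> {Suc a<..c}"
    then have "s \<le> c" by simp
    show "(\<Sum>t\<in>{s<..b}. of_bool (P t < P s) :: int) = of_bool (P b < P s) + (\<Sum>t\<in>{s<..c}. of_bool (P t < P s))"
      unfolding i2[OF \<open>s \<le> c\<close>] using b by (subst sum.insert) auto
  qed
  finally show ?thesis
    unfolding i3 by (simp add: b sum.distrib sum_subtractf)
qed

text \<open>\<open>excess P n b k\<close> is the contribution of the pair \<open>{b, n + 1 - b}\<close> to the number of large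
  minus the number of small letters among the letters placed before position \<open>k\<close>.\<close>

definition excess :: "(nat \<Rightarrow> nat) \<Rightarrow> nat \<Rightarrow> nat \<Rightarrow> nat \<Rightarrow> int" where
  "excess P n b k = of_bool (P (n + 1 - b) < k) - of_bool (P b < k)"

lemma inversions_between_formula:
  fixes P :: "nat \<Rightarrow> nat"
  assumes "inj_on P {0<..n}" "2 * q \<le> n" "d \<le> q"
  shows "inversions_between P d (n - d) =
     (\<Sum>b\<in>{d<..q}. of_bool (P (n + 1 - b) < P b) + (\<Sum>t\<in>{b<..n - b}. 1 + excess P n b (P t)))
     + inversions_between P q (n - q)"
  using assms(3)
proof (induction d rule: inc_induct)
  case (step d)
  have i: "{d<..q} = insert (Suc d) {Suc d<..q}" using step(2) by auto
  have j: "{Suc d<..<n - d} = {Suc d<..n - Suc d}" by auto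
  have "inj_on P {d<..n - d}" by (rule inj_on_subset[OF assms(1)]) auto
  moreover have "Suc d < n - d" using step(2) assms(2) by auto
  ultimately show ?case
    using step(3) unfolding i
    by (subst inversions_between_peel) (auto simp: excess_def j add.assoc algebra_simps)
qed simp

lemma sum_pairs:
  fixes f :: "nat \<Rightarrow> 'a::comm_monoid_add"
  assumes "2 * q \<le> n"
  shows "sum f {0<..n} = (\<Sum>b\<in>{0<..q}. f b + f (n + 1 - b)) + sum f {q<..n - q}"
proof -
  have "{0<..n} = {0<..n - q} \<union> {n - q<..n}" "{0<..n - q} = {0<..q} \<union> {q<..n - q}"
    using assms by auto
  moreover have "sum f ({0<..n - q} \<union> {n - q<..n}) = sum f {0<..n - q} + sum f {n - q<..n}"
    by (rule sum.union_disjoint) auto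
  moreover have "sum f ({0<..q} \<union> {q<..n - q}) = sum f {0<..q} + sum f {q<..n - q}"
    by (rule sum.union_disjoint) auto
  ultimately have "sum f {0<..n} = sum f {0<..q} + sum f {q<..n - q} + sum f {n - q<..n}"
    by (simp only:)
  moreover have "sum f {n - q<..n} = (\<Sum>b\<in>{0<..q}. f (n + 1 - b))"
    by (rule sum.reindex_bij_witness[of _ "\<lambda>b. n + 1 - b" "\<lambda>b. n + 1 - b"]) (use assms in auto)
  ultimately show ?thesis by (simp only: sum.distrib ac_simps)
qed

text \<open>The ones in \<open>inversions_between_formula\<close> at \<open>d = 0\<close> add up to
  the sum of \<open>n - 2 * b\<close> over the pairs, which is \<open>p * q - q\<close>; the
  \<open>- q\<close> is distributed as \<open>- 1\<close> over the pairs. Exchanging the double sum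
  collects the excesses by the letter \<open>t\<close>.\<close>

lemma perm_length_formula:
  assumes w: "w permutes {1..p + q}" and "q \<le> p"
  defines "P \<equiv> inv w" and "n \<equiv> p + q"
  shows "int (perm_length n w) = int p * int q
     + (\<Sum>b\<in>{0<..q}. of_bool (P (n + 1 - b) < P b) - 1)
     + (\<Sum>t\<in>{0<..n}. \<Sum>b\<in>{b\<in>{0<..q}. b < t \<and> t \<le> n - b}. excess P n b (P t))
     + inversions_between P q (n - q)"
proof -
  have le: "2 * q \<le> n" using assms(2) by (simp add: n_def)
  have inj: "inj_on P {0<..n}"
    unfolding P_def using permutes_inj[OF permutes_inv[OF w]] by (rule inj_on_subset) auto
  have "{(s, t). 0 < s \<and> s < t \<and> t \<le> n \<and> P t < P s} = (SIGMA s:{0<..n}. {s<..n} \<inter> {t. P t < P s})"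
    by auto
  then have "perm_length n w = card (SIGMA s:{0<..n}. {s<..n} \<inter> {t. P t < P s})"
    using perm_length_inv[OF w] unfolding P_def n_def by simp
  then have "int (perm_length n w) = inversions_between P 0 (n - 0)"
    by (simp add: inversions_between_def)
  also have "\<dots> = (\<Sum>b\<in>{0<..q}. of_bool (P (n + 1 - b) < P b)) + (\<Sum>b\<in>{0<..q}. \<Sum>t\<in>{b<..n - b}. 1 + excess P n b (P t))
     + inversions_between P q (n - q)"
    by (subst inversions_between_formula[OF inj le]) (simp_all add: sum.distrib)
  also have "(\<Sum>b\<in>{0<..q}. \<Sum>t\<in>{b<..n - b}. 1 + excess P n b (P t))
     = (\<Sum>b\<in>{0<..q}. int (n - b - b)) + (\<Sum>b\<in>{0<..q}. \<Sum>t\<in>{b<..n - b}. excess P n b (P t))"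
    by (simp add: sum.distrib)
  also have "(\<Sum>b\<in>{0<..q}. \<Sum>t\<in>{b<..n - b}. excess P n b (P t))
     = (\<Sum>t\<in>{0<..n}. \<Sum>b\<in>{b\<in>{0<..q}. b < t \<and> t \<le> n - b}. excess P n b (P t))"
  proof -
    have "{b<..n - b} = {t\<in>{0<..n}. b < t \<and> t \<le> n - b}" for b by auto
    then show ?thesis by (simp only:) (rule sum.swap_restrict, auto)
  qed
  also have "(\<Sum>b\<in>{0<..q}. int (n - b - b)) = int p * int q - int q"
  proof -
    \<comment> \<open>The closed form is proved for every \<open>m\<close> by induction;
      \<open>m = q\<close> gives \<open>q * (p - 1)\<close>.\<close>
    have "(\<Sum>b\<in>{0<..m}. int (n - b - b)) = int m * (int n - int m - 1)" if "m \<le> q" for m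
      using that
    proof (induction m)
      case (Suc m)
      have "{0<..Suc m} = insert (Suc m) {0<..m}" by auto
      then show ?case using Suc le by (auto simp: algebra_simps of_nat_diff)
    qed simp
    from this[OF order_refl] show ?thesis by (simp add: n_def algebra_simps)
  qed
  finally show ?thesis by (simp add: sum_subtractf)
qed

text \<open>All three corrections in \<open>perm_length_formula\<close> vanish. In particular, a
  letter \<open>t\<close> inside the pair of \<open>b\<close> stands before or after both letters of
  the pair, so its excess is 0.\<close>

lemma perm_length_nested:
  assumes w: "w permutes {1..p + q}" and "q \<le> p" and nested: "nested_perm (p + q) q w"
  shows "perm_length (p + q) w = p * q"
proof -
  have inj: "inv w s = inv w t \<longleftrightarrow> s = t" for s t
    using permutes_inj[OF permutes_inv[OF w]] by (simp add: inj_eq)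
  have "excess (inv w) (p + q) b (inv w t) = 0" if b: "b \<in> {0<..q}" and t: "b < t" "t \<le> p + q - b" for b t
  proof -
    have "b \<in> {1..q}" "t < p + q + 1 - b" using b t by auto
    then have "inv w (p + q + 1 - b) < inv w b"
        "\<not> (inv w (p + q + 1 - b) < inv w t \<and> inv w t < inv w b)"
      using nested t unfolding nested_perm_def by blast+
    moreover have "inv w t \<noteq> inv w b" using t inj by auto
    ultimately show ?thesis by (auto simp: excess_def)
  qed
  then have "(\<Sum>t\<in>{0<..p + q}. \<Sum>b\<in>{b\<in>{0<..q}. b < t \<and> t \<le> p + q - b}. excess (inv w) (p + q) b (inv w t)) = 0"
    by (intro sum.neutral ballI) auto
  moreover have "(\<Sum>b\<in>{0<..q}. of_bool (inv w (p + q + 1 - b) < inv w b) - 1 :: int) = 0"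
    using nested by (intro sum.neutral ballI) (auto simp: nested_perm_def)
  moreover have "inversions_between (inv w) q (p + q - q) = 0"
    unfolding inversions_between_def
    using nested by (intro sum.neutral ballI) (force simp: nested_perm_def)
  ultimately have "int (perm_length (p + q) w) = int (p * q)"
    using perm_length_formula[OF w assms(2)] by simp
  then show ?thesis by (simp only: of_nat_eq_iff)
qed

text \<open>The corrections to \<open>p * q\<close> in \<open>perm_length_formula\<close> are
  arranged into nonnegative summands, so that each must vanish. The \<open>- 1\<close> from a pair
  in the wrong order is outweighed by the excesses at its two letters.\<close>

lemma nested_perm_if_minimal:
  assumes w: "w permutes {1..p + q}" and "q \<le> p" and len: "perm_length (p + q) w = p * q"
    and ballot: "\<And>a k. a \<le> q \<Longrightarrow> 0 \<le> (\<Sum>b\<in>{0<..a}. excess (inv w) (p + q) b k)"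
  shows "nested_perm (p + q) q w"
proof -
  define n where "n = p + q"
  define P where "P = inv w"
  \<comment> \<open>\<open>D t\<close> sums over the pairs enclosing \<open>t\<close> in value.
    These are the pairs of all \<open>b\<close> up to a bound that is at most \<open>q\<close>, so
    \<open>D t\<close> is a ballot sum.\<close>
  define D where "D t = (\<Sum>b\<in>{b\<in>{0<..q}. b < t \<and> t \<le> n - b}. excess P n b (P t))" for t
  have le: "2 * q \<le> n" using assms(2) by (simp add: n_def)
  have inj: "P s = P t \<longleftrightarrow> s = t" for s t
    using permutes_inj[OF permutes_inv[OF w]] by (simp add: inj_eq P_def)
  have ballot: "0 \<le> (\<Sum>b\<in>{0<..a}. excess P n b k)" if "a \<le> q" for a k
    using ballot[OF that] by (simp add: P_def n_def)
  have D_nonneg: "0 \<le> D t" for t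
  proof -
    have "{b\<in>{0<..q}. b < t \<and> t \<le> n - b} = {0<..min q (min (t - 1) (n - t))}" by auto
    then show ?thesis using ballot[of "min q (min (t - 1) (n - t))"] by (simp add: D_def)
  qed
  have pair_term: "0 \<le> of_bool (P (n + 1 - c) < P c) - 1 + (D c + D (n + 1 - c))"
    "of_bool (P (n + 1 - c) < P c) - 1 + (D c + D (n + 1 - c)) = 0 \<Longrightarrow> P (n + 1 - c) < P c"
    if c: "c \<in> {0<..q}" for c
  proof -
    \<comment> \<open>Let \<open>c\<close> stand before \<open>n + 1 - c\<close>. Just after
      \<open>c\<close>, and again just before \<open>n + 1 - c\<close>, the pair of \<open>c\<close>
      contributes \<open>- 1\<close> to the ballot sum up to \<open>c\<close>, hence the pairs of
      smaller \<open>b\<close> contribute at least 1.\<close>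
    have "1 \<le> D c \<and> 1 \<le> D (n + 1 - c)" if bad: "\<not> P (n + 1 - c) < P c"
    proof -
      have "n + 1 - c \<noteq> c" using c le by auto
      then have bad: "P c < P (n + 1 - c)" using bad inj[of "n + 1 - c" c] by linarith
      have i: "{0<..c} = insert c {0<..<c}" using c by auto
      have "{b\<in>{0<..q}. b < c \<and> c \<le> n - b} = {0<..<c}"
        "{b\<in>{0<..q}. b < n + 1 - c \<and> n + 1 - c \<le> n - b} = {0<..<c}"
        using c le by auto
      then have Dc: "D c = (\<Sum>b\<in>{0<..<c}. excess P n b (P c))"
        "D (n + 1 - c) = (\<Sum>b\<in>{0<..<c}. excess P n b (P (n + 1 - c)))"
        by (simp_all only: D_def)
      have "(\<Sum>b\<in>{0<..<c}. excess P n b (P c)) = (\<Sum>b\<in>{0<..<c}. excess P n b (Suc (P c)))"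
      proof (rule sum.cong[OF refl])
        fix b assume "b \<in> {0<..<c}"
        then have "P b \<noteq> P c" "P (n + 1 - b) \<noteq> P c" using inj c le by auto
        then show "excess P n b (P c) = excess P n b (Suc (P c))"
          by (auto simp: excess_def less_Suc_eq)
      qed
      then have "D c \<ge> 1"
        using ballot[of c "Suc (P c)"] c bad unfolding i Dc by (simp add: excess_def)
      moreover have "D (n + 1 - c) \<ge> 1"
        using ballot[of c "P (n + 1 - c)"] c bad unfolding i Dc by (simp add: excess_def)
      ultimately show ?thesis ..
    qed
    then show "0 \<le> of_bool (P (n + 1 - c) < P c) - 1 + (D c + D (n + 1 - c))"
      "of_bool (P (n + 1 - c) < P c) - 1 + (D c + D (n + 1 - c)) = 0 \<Longrightarrow> P (n + 1 - c) < P c"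
      using D_nonneg[of c] D_nonneg[of "n + 1 - c"] by (cases "P (n + 1 - c) < P c"; simp)+
  qed
  let ?T = "\<lambda>c. of_bool (P (n + 1 - c) < P c) - 1 + (D c + D (n + 1 - c))"
  have "sum D {0<..n} = (\<Sum>c\<in>{0<..q}. D c + D (n + 1 - c)) + sum D {q<..n - q}"
    by (rule sum_pairs[OF le])
  moreover have "int (perm_length n w) = int p * int q + (\<Sum>c\<in>{0<..q}. of_bool (P (n + 1 - c) < P c) - 1)
      + sum D {0<..n} + inversions_between P q (n - q)"
    using perm_length_formula[OF w assms(2)] unfolding P_def n_def D_def .
  ultimately have "sum ?T {0<..q} + sum D {q<..n - q} + inversions_between P q (n - q) = 0"
    using len by (simp add: n_def sum.distrib)
  moreover have "sum ?T {0<..q} \<ge> 0" using pair_term(1) by (rule sum_nonneg)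
  moreover have "sum D {q<..n - q} \<ge> 0" using D_nonneg by (simp add: sum_nonneg)
  moreover have "inversions_between P q (n - q) \<ge> 0"
    unfolding inversions_between_def by (intro sum_nonneg) auto
  ultimately have zero: "sum ?T {0<..q} = 0" "sum D {q<..n - q} = 0" "inversions_between P q (n - q) = 0"
    by linarith+
  have T0: "?T c = 0" if "c \<in> {0<..q}" for c
    using zero(1) pair_term(1) that by (subst (asm) sum_nonneg_eq_0_iff) auto
  have good: "P (n + 1 - c) < P c" if "c \<in> {0<..q}" for c
    using pair_term(2)[OF that T0[OF that]] .
  have D0: "D c = 0 \<and> D (n + 1 - c) = 0" if "c \<in> {0<..q}" for c
    using T0[OF that] good[OF that] D_nonneg[of c] D_nonneg[of "n + 1 - c"] by simp
  have "D t = 0" if "t \<in> {0<..n}" for t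
  proof -
    have "t \<in> {0<..q} \<or> t \<in> {q<..n - q} \<or> (n + 1 - t \<in> {0<..q} \<and> n + 1 - (n + 1 - t) = t)"
      using that le by (simp add: greaterThanAtMost_iff) linarith
    then consider "t \<in> {0<..q}" | "t \<in> {q<..n - q}" | "n + 1 - t \<in> {0<..q}" "n + 1 - (n + 1 - t) = t"
      by blast
    then show ?thesis
    proof cases
      case 2
      then show ?thesis
        using zero(2) D_nonneg by (subst (asm) sum_nonneg_eq_0_iff) auto
    qed (use D0 in \<open>metis\<close>)+
  qed
  moreover have "excess P n b k \<ge> 0" if "b \<in> {0<..q}" for b k
    using good[OF that] by (auto simp: excess_def)
  \<comment> \<open>All pairs are now in the right order, so each excess is nonnegative, and the
    vanishing of \<open>D t\<close> forces each summand to vanish.\<close>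
  ultimately have ex0: "excess P n b (P t) = 0" if "b \<in> {0<..q}" "b < t" "t \<le> n - b" for b t
  proof -
    have "t \<in> {0<..n}" using that by auto
    then have "(\<Sum>b\<in>{b\<in>{0<..q}. b < t \<and> t \<le> n - b}. excess P n b (P t)) = 0"
      using \<open>\<And>t. t \<in> {0<..n} \<Longrightarrow> D t = 0\<close> unfolding D_def by blast
    then show ?thesis
      using that \<open>\<And>b k. b \<in> {0<..q} \<Longrightarrow> excess P n b k \<ge> 0\<close>
      by (subst (asm) sum_nonneg_eq_0_iff) auto
  qed
  have "\<not> (P (n + 1 - b) < P t \<and> P t < P b)" if "b \<in> {1..q}" "b < t" "t < n + 1 - b" for b t
  proof -
    have "b \<in> {0<..q}" "t \<le> n - b" using that by auto
    then show ?thesis using ex0[of b t] that(2) by (auto simp: excess_def split: if_splits)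
  qed
  moreover have "P s < P t" if "q < s \<and> s < t \<and> t \<le> n - q" for s t
  proof -
    have "(\<Sum>t\<in>{s<..n - q}. of_bool (P t < P s) :: int) = 0"
      using zero(3) that unfolding inversions_between_def
      by (subst (asm) sum_nonneg_eq_0_iff) (auto intro!: sum_nonneg)
    then have "\<not> P t < P s"
      using that by (subst (asm) sum_nonneg_eq_0_iff) auto
    then show ?thesis using inj[of s t] that by linarith
  qed
  ultimately show ?thesis
    using good unfolding nested_perm_def n_def P_def by auto
qed

section \<open>Orbits in the flag manifold\<close>

lemma continuous_on_matrix_mult [continuous_intros]:
  fixes f :: "'a::topological_space \<Rightarrow> complex^'n^'m" and g :: "'a \<Rightarrow> complex^'k^'n"
  assumes "continuous_on S f" "continuous_on S g"
  shows "continuous_on S (\<lambda>x. f x ** g x)"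
  unfolding matrix_matrix_mult_def using assms
  by (intro continuous_intros)

lemma continuous_on_matrix_vector_mult [continuous_intros]:
  fixes f :: "'a::topological_space \<Rightarrow> complex^'n^'m" and g :: "'a \<Rightarrow> complex^'n"
  assumes "continuous_on S f" "continuous_on S g"
  shows "continuous_on S (\<lambda>x. f x *v g x)"
  unfolding matrix_vector_mult_def using assms
  by (intro continuous_intros)

lemma act_act: "act g (act h F) = act (g ** h) F"
  by (simp add: act_def image_image matrix_vector_mul_assoc)

lemma act_one: "act (mat 1) F = F"
  by (simp add: act_def)

lemma SLn_mult: "g \<in> SLn \<Longrightarrow> h \<in> SLn \<Longrightarrow> g ** h \<in> SLn"
  by (simp add: SLn_def det_mul)

lemma SLn_invertible: "g \<in> SLn \<Longrightarrow> invertible g"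
  by (simp add: SLn_def invertible_det_nz)

lemma SLn_one: "mat 1 \<in> SLn"
  by (simp add: SLn_def)

lemma SLn_inverse:
  assumes "g \<in> SLn"
  obtains h where "h \<in> SLn" "g ** h = mat 1" "h ** g = mat 1"
proof -
  obtain h where h: "g ** h = mat 1" "h ** g = mat 1"
    using SLn_invertible[OF assms] by (auto simp: invertible_def)
  have "det g * det h = 1" using arg_cong[OF h(1), of det] by (simp add: det_mul)
  then have "h \<in> SLn" using assms by (simp add: SLn_def)
  then show thesis using h that by blast
qed

lemma span_matrix_image: "vec.span ((\<lambda>x. A *v x) ` S) = (\<lambda>x. A *v x) ` vec.span S"
  for A :: "complex^'n^'m"
  by (rule vec.linear_span_image[OF matrix_vector_mul_linear_gen])

lemma act_flag_of_basis: "act g (flag_of_basis v) = flag_of_basis (\<lambda>i. g *v v i)"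
  by (simp add: act_def flag_of_basis_def image_image flip: span_matrix_image)

lemma mat_vector_mult: "mat c *v x = c *s x" for x :: "complex^'n"
  by (vector mat_def matrix_vector_mult_def) (simp add: if_distrib if_distribR cong: if_cong)

lemma subspace_scale_image:
  fixes V :: "(complex^'n) set"
  assumes "vec.subspace V" "c \<noteq> 0"
  shows "(\<lambda>x. c *s x) ` V = V"
proof
  show "(\<lambda>x. c *s x) ` V \<subseteq> V" using vec.subspace_scale[OF assms(1)] by auto
  show "V \<subseteq> (\<lambda>x. c *s x) ` V"
  proof
    fix x assume "x \<in> V"
    then have "inverse c *s x \<in> V" "x = c *s (inverse c *s x)"
      using vec.subspace_scale[OF assms(1)] assms(2) by (auto simp: vec_eq_iff)
    then show "x \<in> (\<lambda>x. c *s x) ` V" by blast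
  qed
qed

lemma det_mat: "det (mat c :: complex^'n^'n) = c ^ CARD('n)"
  by (subst det_diagonal) (simp_all add: mat_def)

text \<open>Nonzero scalars fix every subspace, so an invertible matrix may be rescaled to
  determinant 1 without changing its action on flags.\<close>

lemma act_scale:
  fixes g :: "complex^'n^'n"
  assumes "c \<noteq> 0" "\<And>k. vec.subspace (F k)"
  shows "act (mat c ** g) F = act g F"
proof
  fix k
  have "vec.subspace ((\<lambda>x. g *v x) ` F k)"
    by (rule vec.linear_subspace_image[OF matrix_vector_mul_linear_gen assms(2)])
  then have "(\<lambda>x. c *s x) ` ((\<lambda>x. g *v x) ` F k) = (\<lambda>x. g *v x) ` F k"
    by (rule subspace_scale_image[OF _ assms(1)])
  then show "act (mat c ** g) F k = act g F k"
    by (simp add: act_def image_image mat_vector_mult flip: matrix_vector_mul_assoc)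
qed

text \<open>For \<open>det g \<noteq> 0\<close> this is a root of order \<open>CARD('n)\<close> of
  \<open>1 / det g\<close>. The principal logarithm makes it tend to 1 as \<open>g\<close> tends to
  the identity.\<close>

definition sl_scale :: "complex^'n^'n \<Rightarrow> complex" where
  "sl_scale g = exp (- Ln (det g) / of_nat CARD('n))"

lemma sl_scale:
  fixes g :: "complex^'n^'n"
  assumes "det g \<noteq> 0"
  shows "sl_scale g \<noteq> 0" "mat (sl_scale g) ** g \<in> SLn"
proof -
  have "sl_scale g ^ CARD('n) = exp (- Ln (det g))"
    unfolding sl_scale_def exp_of_nat_mult[symmetric] by simp
  then show "mat (sl_scale g) ** g \<in> SLn"
    using assms by (simp add: SLn_def det_mul det_mat exp_minus)
qed (simp add: sl_scale_def)

text \<open>Translation by group elements carries the neighbourhood \<open>T\<close> of the identity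
  to every point of the preimage of the orbit.\<close>

lemma openin_orbit_of:
  fixes H :: "(complex^'n^'n) set"
  assumes F0: "F0 \<in> complete_flags" and H: "H \<subseteq> SLn" "\<And>s t. s \<in> H \<Longrightarrow> t \<in> H \<Longrightarrow> s ** t \<in> H"
    and T: "openin (top_of_set SLn) T" "mat 1 \<in> T" "\<And>g. g \<in> T \<Longrightarrow> act g F0 \<in> orbit_of H F0"
  shows "openin flag_topology (orbit_of H F0)"
  unfolding openin_flag_topology
proof (intro conjI ballI)
  show "orbit_of H F0 \<subseteq> complete_flags"
    using act_complete_flags[OF _ F0] H(1) by (auto simp: orbit_of_def)
next
  fix F :: "nat \<Rightarrow> (complex^'n) set" assume "F \<in> complete_flags"
  let ?X = "{g \<in> SLn. act g F \<in> orbit_of H F0}"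
  show "openin (top_of_set SLn) ?X"
  proof (subst openin_subopen, intro ballI)
    fix g0 assume "g0 \<in> ?X"
    then obtain s where g0: "g0 \<in> SLn" and s: "s \<in> H" "act g0 F = act s F0"
      by (auto simp: orbit_of_def)
    obtain a where a: "a \<in> SLn" "g0 ** a = mat 1" "a ** g0 = mat 1" using SLn_inverse[OF g0] .
    obtain r where r: "r \<in> SLn" "s ** r = mat 1" "r ** s = mat 1" using SLn_inverse[of s] H(1) s(1) by blast
    have F: "F = act (a ** s) F0"
      using arg_cong[OF s(2), of "act a"] a(3) by (simp add: act_act act_one)
    \<comment> \<open>With \<open>a\<close> and \<open>r\<close> the inverses of \<open>g0\<close>
      and \<open>s\<close>, this map sends \<open>g0\<close> to the identity and satisfies
      \<open>act g F = act s (act (\<phi> g) F0)\<close>.\<close>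
    define \<phi> where "\<phi> g = r ** (g ** (a ** s))" for g
    have "\<phi> \<in> SLn \<rightarrow> SLn"
      using a(1) r(1) s(1) H(1) by (auto simp: \<phi>_def intro!: SLn_mult)
    moreover have "continuous_on SLn \<phi>" unfolding \<phi>_def by (intro continuous_intros)
    ultimately have "openin (top_of_set SLn) (SLn \<inter> \<phi> -` T)"
      using T(1) by (metis continuous_openin_preimage)
    moreover have "\<phi> g0 = mat 1"
      using a r by (simp add: \<phi>_def matrix_mul_assoc)
    then have "g0 \<in> SLn \<inter> \<phi> -` T" using g0 T(2) by simp
    moreover have "SLn \<inter> \<phi> -` T \<subseteq> ?X"
    proof
      fix g assume g: "g \<in> SLn \<inter> \<phi> -` T"
      then obtain t where t: "t \<in> H" "act (\<phi> g) F0 = act t F0"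
        using T(3)[of "\<phi> g"] by (auto simp: orbit_of_def)
      have "s ** \<phi> g = g ** (a ** s)"
        using r(2) by (simp add: \<phi>_def matrix_mul_assoc)
      then have "act g F = act s (act (\<phi> g) F0)"
        by (simp add: F act_act)
      also have "\<dots> = act (s ** t) F0" by (simp add: t act_act)
      finally show "g \<in> ?X" using g H(2)[OF s(1) t(1)] by (auto simp: orbit_of_def)
    qed
    ultimately show "\<exists>T. openin (top_of_set SLn) T \<and> g0 \<in> T \<and> T \<subseteq> ?X" by blast
  qed
qed

lemma scaleR_eq_scalar_mult: "r *\<^sub>R x = of_real r *s x" for x :: "complex^'n"
  unfolding vec_eq_iff by (simp add: scaleR_conv_of_real[where 'a = complex])

lemma closed_vec_subspace:
  fixes V :: "(complex^'n) set"
  assumes "vec.subspace V"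
  shows "closed V"
proof -
  have "subspace V"
    using assms unfolding subspace_def vec.subspace_def scaleR_eq_scalar_mult by blast
  then show ?thesis by (rule closed_subspace)
qed

text \<open>For \<open>g \<in> SLn\<close>, the subspace \<open>act g F k\<close> meets
  \<open>E\<close> nontrivially iff \<open>g\<close> maps a unit vector of \<open>F k\<close> into
  \<open>E\<close>. The unit sphere of \<open>F k\<close> is compact, so these \<open>g\<close> form
  the projection of a closed set along a compact factor, which is closed. Such open sets later
  separate Schubert varieties.\<close>

lemma openin_transverse_flags:
  fixes E :: "(complex^'n) set"
  assumes E: "vec.subspace E"
  shows "openin flag_topology {F \<in> complete_flags. F k \<inter> E = {0}}"
  unfolding openin_flag_topology
proof (intro conjI ballI)
  fix F :: "nat \<Rightarrow> (complex^'n) set" assume F: "F \<in> complete_flags"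
  then have Fk: "vec.subspace (F k)" by (simp add: complete_flags_def)
  let ?S = "F k \<inter> sphere 0 1"
  let ?C = "{g. \<exists>x. x \<in> ?S \<and> (x, g) \<in> {(x, g). g *v x \<in> E}}"
  have "compact ?S"
    using closed_vec_subspace[OF Fk] by (simp add: closed_Int_compact)
  moreover have "closed {(x, g :: complex^'n^'n). g *v x \<in> E}"
  proof -
    have "continuous_on UNIV (\<lambda>z :: (complex^'n) \<times> (complex^'n^'n). snd z *v fst z)"
      by (intro continuous_intros)
    then have "closed ((\<lambda>z :: (complex^'n) \<times> (complex^'n^'n). snd z *v fst z) -` E)"
      by (intro closed_vimage closed_vec_subspace[OF E])
    then show ?thesis by (simp add: vimage_def case_prod_beta')
  qed
  ultimately have "closed ?C" by (rule closed_compact_projection)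
  then have "openin (top_of_set SLn) (SLn \<inter> - ?C)"
    by (simp add: openin_open_Int open_Compl)
  moreover have "{g \<in> SLn. act g F \<in> {F \<in> complete_flags. F k \<inter> E = {0}}} = SLn \<inter> - ?C"
  proof -
    have "act g F k \<inter> E = {0} \<longleftrightarrow> g \<notin> ?C" if g: "g \<in> SLn" for g
    proof -
      have inj: "g *v x = 0 \<longleftrightarrow> x = 0" for x
        using inj_matrix_vector_mult[OF SLn_invertible[OF g]]
        by (metis injD matrix_vector_mult_0_right)
      have "act g F k \<inter> E \<noteq> {0} \<longleftrightarrow> (\<exists>x\<in>F k. x \<noteq> 0 \<and> g *v x \<in> E)"
        using vec.subspace_0[OF E] vec.subspace_0[OF Fk] inj by (fastforce simp: act_def)
      also have "\<dots> \<longleftrightarrow> (\<exists>x\<in>?S. g *v x \<in> E)"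
      proof
        assume "\<exists>x\<in>F k. x \<noteq> 0 \<and> g *v x \<in> E"
        then obtain x where x: "x \<in> F k" "x \<noteq> 0" "g *v x \<in> E" by blast
        let ?c = "of_real (inverse (norm x)) :: complex"
        have "?c *s x = inverse (norm x) *\<^sub>R x"
          by (simp only: scaleR_eq_scalar_mult)
        then have "norm (?c *s x) = 1" using x(2) by simp
        moreover have "?c *s x \<in> F k" using x(1) vec.subspace_scale[OF Fk] by blast
        moreover have "g *v (?c *s x) \<in> E"
          using x(3) vec.subspace_scale[OF E] by (simp only: vector_scalar_commute)
        ultimately show "\<exists>x\<in>?S. g *v x \<in> E" by auto
      next
        assume "\<exists>x\<in>?S. g *v x \<in> E"
        then obtain x where "x \<in> F k" "norm x = 1" "g *v x \<in> E" by auto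
        then show "\<exists>x\<in>F k. x \<noteq> 0 \<and> g *v x \<in> E" by (intro bexI[of _ x]) auto
      qed
      finally show ?thesis by blast
    qed
    then show ?thesis using act_complete_flags[OF _ F] by auto
  qed
  ultimately show "openin (top_of_set SLn) {g \<in> SLn. act g F \<in> {F \<in> complete_flags. F k \<inter> E = {0}}}"
    by simp
qed auto

section \<open>The Hermitian form on flags\<close>

lemma complete_flags_subspace: "F \<in> complete_flags \<Longrightarrow> vec.subspace (F k)"
  by (simp add: complete_flags_def)

lemma complete_flags_dim:
  fixes F :: "nat \<Rightarrow> (complex^'n) set"
  shows "F \<in> complete_flags \<Longrightarrow> vec.dim (F k) = min k CARD('n)"
  by (simp add: complete_flags_def)

lemma complete_flags_mono: "F \<in> complete_flags \<Longrightarrow> i \<le> j \<Longrightarrow> F i \<subseteq> F j"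
  by (rule lift_Suc_mono_le[of F]) (auto simp: complete_flags_def)

lemma complete_flags_Suc_eq_span:
  fixes F :: "nat \<Rightarrow> (complex^'n) set"
  assumes F: "F \<in> complete_flags" and z: "z \<in> F (Suc m)" "z \<notin> F m"
  shows "F (Suc m) = vec.span (insert z (F m))"
proof (rule sym, rule vec.subspace_dim_equal)
  have "insert z (F m) \<subseteq> F (Suc m)"
    using z(1) complete_flags_mono[OF F, of m "Suc m"] by auto
  then show "vec.span (insert z (F m)) \<subseteq> F (Suc m)"
    by (rule vec.span_minimal[OF _ complete_flags_subspace[OF F]])
  have "z \<notin> vec.span (F m)"
    using z(2) complete_flags_subspace[OF F, of m] by (metis vec.span_eq_iff)
  then have "vec.dim (vec.span (insert z (F m))) = vec.dim (F m) + 1"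
    by (simp add: vec.dim_insert)
  then show "vec.dim (F (Suc m)) \<le> vec.dim (vec.span (insert z (F m)))"
    by (simp add: complete_flags_dim[OF F])
qed (use complete_flags_subspace[OF F] in auto)

section \<open>The form in coordinates and on the Iwasawa basis\<close>

locale indefinite_space =
  fixes p q :: nat and idx :: "nat \<Rightarrow> 'n::finite"
  assumes q_le_p: "q \<le> p" and card_n: "CARD('n) = p + q"
    and bij_idx: "bij_betw idx {1..p + q} UNIV"
begin

abbreviation herm :: "complex^'n \<Rightarrow> complex^'n \<Rightarrow> complex" where
  "herm \<equiv> herm_form p q idx"

abbreviation e :: "nat \<Rightarrow> complex^'n" where
  "e \<equiv> std_basis idx"

abbreviation u :: "nat \<Rightarrow> complex^'n" where
  "u \<equiv> iwasawa_basis p q idx"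

definition sig :: "nat \<Rightarrow> complex" where
  "sig i = (if i \<le> q then - 1 else 1)"

lemma herm_eq: "herm x y = (\<Sum>i\<in>{1..p + q}. sig i * (x $ idx i * cnj (y $ idx i)))"
proof -
  have "{1..p + q} = {1..q} \<union> {q + 1..q + p}" by auto
  then have "(\<Sum>i\<in>{1..p + q}. sig i * (x $ idx i * cnj (y $ idx i))) =
      (\<Sum>i\<in>{1..q}. sig i * (x $ idx i * cnj (y $ idx i))) + (\<Sum>i\<in>{q + 1..q + p}. sig i * (x $ idx i * cnj (y $ idx i)))"
    by (simp only:) (rule sum.union_disjoint, auto)
  also have "(\<Sum>i\<in>{q + 1..q + p}. sig i * (x $ idx i * cnj (y $ idx i))) = (\<Sum>i\<in>{1..p}. x $ idx (q + i) * cnj (y $ idx (q + i)))"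
    by (rule sum.reindex_bij_witness[of _ "\<lambda>i. q + i" "\<lambda>i. i - q"]) (auto simp: sig_def)
  finally show ?thesis
    by (simp add: herm_form_def sig_def sum_negf)
qed

lemma herm_add_left: "herm (x + y) z = herm x z + herm y z"
  by (simp add: herm_eq algebra_simps sum.distrib)

lemma herm_scale_left: "herm (c *s x) z = c * herm x z"
  by (simp add: herm_eq sum_distrib_left mult_ac)

lemma cnj_herm: "cnj (herm x y) = herm y x"
proof -
  have "cnj (sig i) = sig i" for i by (simp add: sig_def)
  then show ?thesis by (simp add: herm_eq mult_ac)
qed

lemma herm_add_right: "herm x (y + z) = herm x y + herm x z"
  by (metis cnj_herm complex_cnj_add herm_add_left)

lemma herm_scale_right: "herm x (c *s y) = cnj c * herm x y"
  by (metis cnj_herm complex_cnj_mult herm_scale_left)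

lemma herm_diff_left: "herm (x - y) z = herm x z - herm y z"
  using herm_add_left[of "x - y" y z] by simp

lemma herm_diff_right: "herm x (y - z) = herm x y - herm x z"
  using herm_add_right[of x "y - z" z] by simp

lemma herm_zero_left [simp]: "herm 0 z = 0"
  by (simp add: herm_eq)

lemma herm_zero_right [simp]: "herm z 0 = 0"
  by (simp add: herm_eq)

lemma herm_sum_left: "herm (sum f S) z = (\<Sum>i\<in>S. herm (f i) z)"
  by (induction S rule: infinite_finite_induct) (simp_all add: herm_add_left)

lemma herm_eq_0_commute: "herm x y = 0 \<longleftrightarrow> herm y x = 0"
  by (metis cnj_herm complex_cnj_zero_iff)

lemmas herm_simps = herm_add_left herm_add_right herm_diff_left herm_diff_right
  herm_scale_left herm_scale_right

text \<open>These are the rank-one maps from which \<open>transvection_path\<close> is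
  built.\<close>

lemma linear_herm: "Vector_Spaces.linear (*s) (*s) (\<lambda>x. herm x y *s z)"
  by unfold_locales (simp_all add: herm_simps vec_eq_iff algebra_simps)

lemma subspace_orthogonal: "vec.subspace {y. herm x y = 0}"
  by (auto simp: vec.subspace_def herm_simps)

lemma herm_span_eq_0:
  assumes "\<And>y. y \<in> S \<Longrightarrow> herm x y = 0" "y \<in> vec.span S"
  shows "herm x y = 0"
proof -
  have "vec.span S \<subseteq> {y. herm x y = 0}"
    by (rule vec.span_minimal[OF _ subspace_orthogonal]) (use assms(1) in auto)
  then show ?thesis using assms(2) by auto
qed

lemma e_nth: "i \<in> {1..p + q} \<Longrightarrow> j \<in> {1..p + q} \<Longrightarrow> e i $ idx j = of_bool (i = j)"
  using inj_on_eq_iff[OF bij_betw_imp_inj_on[OF bij_idx], of j i]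
  by (simp add: std_basis_def axis_def)

lemma herm_e_right:
  assumes "i \<in> {1..p + q}"
  shows "herm x (e i) = sig i * x $ idx i"
proof -
  have "herm x (e i) = (\<Sum>j\<in>{1..p + q}. if j = i then sig i * x $ idx i else 0)"
    unfolding herm_eq by (rule sum.cong) (use assms in \<open>auto simp: e_nth\<close>)
  then show ?thesis using assms by simp
qed

lemma herm_e_e:
  assumes "i \<in> {1..p + q}" "j \<in> {1..p + q}"
  shows "herm (e i) (e j) = (if i = j then sig i else 0)"
  using assms by (simp add: herm_e_right e_nth)

lemma sig_nonzero [simp]: "sig i \<noteq> 0"
  by (simp add: sig_def)

lemma herm_nondegenerate: "(\<And>y. herm x y = 0) \<Longrightarrow> x = 0"
proof -
  assume *: "\<And>y. herm x y = 0"
  have "x $ k = 0" for k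
  proof -
    obtain i where "i \<in> {1..p + q}" "k = idx i"
      using bij_betw_imp_surj_on[OF bij_idx] by blast
    then show ?thesis using herm_e_right[of i x] * by simp
  qed
  then show ?thesis by (simp add: vec_eq_iff)
qed

lemma u_low: "i \<le> q \<Longrightarrow> u i = e i + e (2 * q + 1 - i)"
  by (simp add: iwasawa_basis_def)

lemma u_mid: "q < i \<Longrightarrow> i \<le> p \<Longrightarrow> u i = e (q + i)"
  by (simp add: iwasawa_basis_def)

lemma u_high:
  assumes "1 \<le> b" "b \<le> q"
  shows "u (p + q + 1 - b) = e b - e (2 * q + 1 - b)"
proof -
  have "\<not> p + q + 1 - b \<le> q" "\<not> p + q + 1 - b \<le> p" "p + q + 1 - (p + q + 1 - b) = b"
    using assms q_le_p by linarith+
  then show ?thesis by (simp only: iwasawa_basis_def Let_def if_False)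
qed

text \<open>The vector \<open>u i\<close> with \<open>i \<le> q\<close> is isotropic because its two
  coordinates contribute \<open>- 1\<close> and 1, and it is orthogonal to every basis vector
  \<open>u j\<close> except the one with \<open>j = p + q + 1 - i\<close>; the bound on
  \<open>j\<close> excludes that index.\<close>

lemma herm_u_u:
  assumes "1 \<le> i" "i \<le> a" "a \<le> q" "1 \<le> j" "j \<le> p + q - a"
  shows "herm (u i) (u j) = 0"
proof -
  define i' where "i' = 2 * q + 1 - i"
  have ui: "u i = e i + e i'" using assms by (simp add: u_low i'_def)
  have i: "i \<in> {1..p + q}" "i' \<in> {1..p + q}" "i \<le> q" "\<not> i' \<le> q" "i \<noteq> i'" "i' \<noteq> i" "i' \<le> 2 * q"
    using assms q_le_p by (auto simp: i'_def)
  consider "j \<le> q" | "q < j" "j \<le> p" | "p < j" by linarith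
  then show ?thesis
  proof cases
    case 1
    define j' where "j' = 2 * q + 1 - j"
    have uj: "u j = e j + e j'" using 1 by (simp add: u_low j'_def)
    have "j \<in> {1..p + q}" "j' \<in> {1..p + q}" "\<not> j' \<le> q" "i \<noteq> j'" "i' \<noteq> j" "i' = j' \<longleftrightarrow> i = j"
      using 1 assms q_le_p by (auto simp: i'_def j'_def)
    with i 1 show ?thesis unfolding ui uj herm_simps by (simp add: herm_e_e sig_def)
  next
    case 2
    then have "q + j \<in> {1..p + q}" "i \<noteq> q + j" "i' \<noteq> q + j" using i by auto
    with i 2 show ?thesis by (simp add: ui u_mid herm_simps herm_e_e)
  next
    case 3
    define b where "b = p + q + 1 - j"
    define b' where "b' = 2 * q + 1 - b"
    have j: "j = p + q + 1 - b" "1 \<le> b" "b \<le> q" "i < b" using 3 assms q_le_p by (auto simp: b_def)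
    have uj: "u j = e b - e b'" using u_high[OF j(2,3)] j(1) by (simp add: b'_def)
    have "b \<in> {1..p + q}" "b' \<in> {1..p + q}" "i \<noteq> b" "i \<noteq> b'" "i' \<noteq> b" "i' \<noteq> b'"
      using j i q_le_p by (auto simp: b'_def i'_def)
    with i show ?thesis unfolding ui uj herm_simps by (simp add: herm_e_e)
  qed
qed

section \<open>Orthogonal bases of flags\<close>

definition residual :: "(nat \<Rightarrow> complex^'n) \<Rightarrow> nat set \<Rightarrow> complex^'n \<Rightarrow> complex^'n" where
  "residual v J z = z - (\<Sum>j\<in>J. (herm z (v j) / herm (v j) (v j)) *s v j)"

text \<open>The form is indefinite, so the vectors are explicitly required to be non-isotropic; this
  makes the denominators in \<open>residual\<close> nonzero.\<close>

definition orthogonal_on :: "(nat \<Rightarrow> complex^'n) \<Rightarrow> nat set \<Rightarrow> bool" where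
  "orthogonal_on v J \<longleftrightarrow> (\<forall>i\<in>J. \<forall>j\<in>J. i \<noteq> j \<longrightarrow> herm (v i) (v j) = 0) \<and> (\<forall>i\<in>J. herm (v i) (v i) \<noteq> 0)"

lemma herm_residual:
  assumes "orthogonal_on v J" "finite J" "j \<in> J"
  shows "herm (residual v J z) (v j) = 0"
proof -
  have "herm (\<Sum>i\<in>J. (herm z (v i) / herm (v i) (v i)) *s v i) (v j)
      = (\<Sum>i\<in>J. if i = j then herm z (v j) else 0)"
    unfolding herm_sum_left
    by (rule sum.cong) (use assms in \<open>auto simp: herm_simps orthogonal_on_def\<close>)
  then show ?thesis using assms by (simp add: residual_def herm_diff_left)
qed

lemma residual_in_span: "z - residual v J z \<in> vec.span (v ` J)"
  by (simp add: residual_def) (intro vec.span_sum vec.span_scale vec.span_base imageI)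

definition nondegenerate :: "(complex^'n) set \<Rightarrow> bool" where
  "nondegenerate V \<longleftrightarrow> (\<forall>x\<in>V. (\<forall>y\<in>V. herm x y = 0) \<longrightarrow> x = 0)"

text \<open>The vector \<open>z\<close> is the residual of a vector of \<open>F (Suc m)\<close>
  outside \<open>F m\<close>. It may be isotropic, so the step also applies to the first degenerate
  subspace of a flag.\<close>

lemma orthogonal_step:
  assumes F: "F \<in> complete_flags" and m: "m < p + q"
    and v: "orthogonal_on v {1..m}" "F m = vec.span (v ` {1..m})"
  obtains z where "F (Suc m) = vec.span (insert z (v ` {1..m}))" "z \<notin> F m"
    "\<And>f. f \<in> F m \<Longrightarrow> herm z f = 0"
proof -
  have "\<not> F (Suc m) \<subseteq> F m"
  proof
    assume "F (Suc m) \<subseteq> F m"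
    then have "vec.dim (F (Suc m)) \<le> vec.dim (F m)" by (rule vec.dim_subset)
    then show False using m by (simp add: complete_flags_dim[OF F] card_n)
  qed
  then obtain y where y: "y \<in> F (Suc m)" "y \<notin> F m" by blast
  define z where "z = residual v {1..m} y"
  have diff: "y - z \<in> F m" using residual_in_span v(2) by (auto simp: z_def)
  have sub: "vec.subspace (F i)" for i by (rule complete_flags_subspace[OF F])
  have zm: "z \<notin> F m"
    using y(2) diff vec.subspace_add[OF sub diff] by fastforce
  have "z \<in> F (Suc m)"
    using vec.subspace_diff[OF sub y(1), of "y - z"] diff complete_flags_mono[OF F, of m "Suc m"] by auto
  then have "F (Suc m) = vec.span (insert z (F m))"
    by (rule complete_flags_Suc_eq_span[OF F _ zm])
  also have "\<dots> = vec.span (insert z (v ` {1..m}))"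
    unfolding v(2) vec.span_insert vec.span_span ..
  finally have "F (Suc m) = vec.span (insert z (v ` {1..m}))" .
  moreover have "herm z f = 0" if "f \<in> F m" for f
    using herm_residual[OF v(1)] unfolding z_def
    by (intro herm_span_eq_0[OF _ that[unfolded v(2)]]) auto
  ultimately show thesis using zm that by blast
qed

text \<open>An isotropic new vector \<open>z\<close> would be orthogonal to all of
  \<open>F (Suc m)\<close>, against nondegeneracy.\<close>

lemma orthogonal_basis_of_flag:
  assumes F: "F \<in> complete_flags" and m: "m \<le> p + q" and nd: "\<And>j. j \<le> m \<Longrightarrow> nondegenerate (F j)"
  shows "\<exists>v. orthogonal_on v {1..m} \<and> F m = vec.span (v ` {1..m})"
  using m nd
proof (induction m)
  case 0
  have "F 0 = {0}"
    using complete_flags_dim[OF F, of 0] complete_flags_subspace[OF F, of 0]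
    by (metis min_0L vec.dim_eq_0 vec.subspace_0 subset_singletonD empty_iff)
  then show ?case by (intro exI[of _ undefined]) (simp add: orthogonal_on_def)
next
  case (Suc m)
  then obtain v where v: "orthogonal_on v {1..m}" "F m = vec.span (v ` {1..m})" by auto
  from Suc.prems(1) have "m < p + q" by simp
  from orthogonal_step[OF F this v] obtain z where
    z: "F (Suc m) = vec.span (insert z (v ` {1..m}))" "z \<notin> F m" "\<And>f. f \<in> F m \<Longrightarrow> herm z f = 0" by metis
  have zv: "herm z (v j) = 0" if "j \<in> {1..m}" for j
    using that by (intro z(3)) (auto simp: v(2) intro: vec.span_base)
  then have vz: "herm (v j) z = 0" if "j \<in> {1..m}" for j
    using that by (simp add: herm_eq_0_commute[of "v j"])
  have "herm z z \<noteq> 0"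
  proof
    assume "herm z z = 0"
    then have "herm z f = 0" if "f \<in> F (Suc m)" for f
      using zv by (intro herm_span_eq_0[OF _ that[unfolded z(1)]]) auto
    moreover have "z \<in> F (Suc m)" unfolding z(1) by (auto intro: vec.span_base)
    ultimately have "z = 0" using Suc.prems(2)[of "Suc m"] by (auto simp: nondegenerate_def)
    then show False using z(2) vec.subspace_0[OF complete_flags_subspace[OF F]] by auto
  qed
  let ?v = "v(Suc m := z)"
  have i: "{1..Suc m} = insert (Suc m) {1..m}" by auto
  have "orthogonal_on ?v {1..Suc m}"
    using v(1) zv vz \<open>herm z z \<noteq> 0\<close> unfolding i orthogonal_on_def by auto
  moreover have "?v ` {1..Suc m} = insert z (v ` {1..m})" unfolding i by auto
  ultimately show ?case using z(1) by (intro exI[of _ ?v]) (simp only: simp_thms)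
qed

section \<open>From nondegenerate flags to the ballot condition\<close>

text \<open>Each of the linear conditions lowers the dimension by at most one.\<close>

lemma kernel_vector:
  assumes "finite B" "vec.subspace V" "card B < vec.dim V"
  shows "\<exists>x\<in>V. x \<noteq> 0 \<and> (\<forall>b\<in>B. herm x (z b) = 0)"
  using assms
proof (induction B arbitrary: V rule: finite_induct)
  case empty
  then have "\<not> V \<subseteq> {0}" by (metis vec.dim_eq_0 card.empty less_irrefl)
  then show ?case by auto
next
  case (insert b B)
  let ?V = "{x \<in> V. herm x (z b) = 0}"
  have "vec.subspace ?V"
    using insert.prems(1) by (auto simp: vec.subspace_def herm_simps)
  moreover have "vec.dim V \<le> vec.dim ?V + 1"
  proof (cases "?V = V")
    case False
    then obtain x where x: "x \<in> V" "herm x (z b) \<noteq> 0" by auto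
    have "V \<subseteq> vec.span (insert x ?V)"
    proof
      fix y assume y: "y \<in> V"
      let ?c = "herm y (z b) / herm x (z b)"
      have "y - ?c *s x \<in> ?V"
        using y x vec.subspace_diff[OF insert.prems(1)] vec.subspace_scale[OF insert.prems(1)]
        by (auto simp: herm_simps)
      then show "y \<in> vec.span (insert x ?V)"
        unfolding vec.span_insert by (auto intro: vec.span_base)
    qed
    then have "vec.dim V \<le> vec.dim (vec.span (insert x ?V))" by (rule vec.dim_subset)
    also have "\<dots> \<le> vec.dim ?V + 1" by (simp add: vec.dim_insert)
    finally show ?thesis .
  qed simp
  then have "card B < vec.dim ?V" using insert by simp
  ultimately obtain x where "x \<in> ?V" "x \<noteq> 0" "\<forall>b\<in>B. herm x (z b) = 0"
    using insert.IH[of ?V] by blast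
  then show ?case by auto
qed

lemma u_independent: "inj_on u {1..p + q}" "vec.independent (u ` {1..p + q})" "vec.span (u ` {1..p + q}) = UNIV"
proof -
  have "flag_of_basis (u \<circ> id) \<in> complete_flags"
    by (rule flag_of_iwasawa_basis[OF q_le_p card_n bij_idx permutes_id])
  from complete_flags_dim[OF this, of "p + q"]
  have dim: "vec.dim (u ` {1..p + q}) = p + q"
    by (simp only: flag_of_basis_def vec.dim_span card_n id_apply min.idem comp_id)
  then have "p + q \<le> card (u ` {1..p + q})"
    using vec.dim_le_card'[of "u ` {1..p + q}"] by (simp only: finite_imageI finite_atLeastAtMost)
  then have card: "card (u ` {1..p + q}) = p + q" using card_image_le[of "{1..p + q}" u] by simp
  then show "inj_on u {1..p + q}" by (intro eq_card_imp_inj_on) auto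
  show "vec.independent (u ` {1..p + q})"
    by (rule vec.card_le_dim_spanning[of _ "u ` {1..p + q}"])
       (simp_all only: dim card finite_imageI finite_atLeastAtMost vec.span_superset order_refl)
  show "vec.span (u ` {1..p + q}) = UNIV"
  proof (rule vec.subspace_dim_equal)
    show "vec.dim (UNIV :: (complex^'n) set) \<le> vec.dim (vec.span (u ` {1..p + q}))"
      unfolding vec.dim_span dim vec_dim_card card_n by (rule order_refl)
  qed (rule vec.subspace_span vec.subspace_UNIV subset_UNIV)+
qed

lemma dim_image_u:
  assumes "A \<subseteq> {1..p + q}" "invertible g"
  shows "vec.dim ((\<lambda>t. g *v u t) ` A) = card A"
proof -
  have "vec.dim ((\<lambda>x. g *v x) ` (u ` A)) = vec.dim (u ` A)"
    by (rule vec.dim_image_eq[OF matrix_vector_mul_linear_gen])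
       (rule inj_on_subset[OF inj_matrix_vector_mult[OF assms(2)] subset_UNIV])
  also have "\<dots> = card (u ` A)"
    by (rule vec.dim_eq_card_independent, rule vec.independent_mono[OF u_independent(2)]) (use assms(1) in auto)
  also have "\<dots> = card A"
    by (rule card_image, rule inj_on_subset[OF u_independent(1) assms(1)])
  finally show ?thesis unfolding image_image .
qed

lemma borel_span:
  assumes "g \<in> iwasawa_borel p q idx"
  shows "(\<lambda>x. g *v x) ` vec.span (u ` {1..k}) = vec.span (u ` {1..k})"
proof -
  have "act g (flag_of_basis u) k = flag_of_basis u k" using assms by (simp add: iwasawa_borel_def)
  then show ?thesis by (simp add: act_def flag_of_basis_def)
qed

text \<open>A negative sum would produce a nonzero vector in the radical of the subspace with index
  \<open>k - 1\<close>. It lies in the span of \<open>u 1, ..., u a\<close>, which \<open>g\<close>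
  preserves and which is orthogonal to \<open>u 1, ..., u (p + q - a)\<close>. More letters of
  \<open>1, ..., a\<close> than partners stand before position \<open>k\<close>, which leaves room
  to make it orthogonal to the remaining vectors of that subspace too.\<close>

lemma ballot_if_nondegenerate:
  assumes w: "w permutes {1..p + q}" and g: "g \<in> iwasawa_borel p q idx"
    and nd: "\<And>k. nondegenerate (act g (flag_of_basis (u \<circ> w)) k)" and a: "a \<le> q"
  shows "0 \<le> (\<Sum>b\<in>{0<..a}. excess (inv w) (p + q) b k)"
proof (rule ccontr)
  define P where "P = inv w"
  have P_in: "P i \<in> {1..p + q} \<longleftrightarrow> i \<in> {1..p + q}" for i
    using permutes_in_image[OF permutes_inv[OF w]] by (simp add: P_def)
  have wP: "w (P i) = i" "P (w i) = i" for i
    using permutes_inverses[OF w] by (auto simp: P_def)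
  define A where "A = {0<..a} \<inter> {b. P b < k}"
  define B where "B = {0<..a} \<inter> {b. P (p + q + 1 - b) < k}"
  assume "\<not> 0 \<le> (\<Sum>b\<in>{0<..a}. excess (inv w) (p + q) b k)"
  then have neg: "(\<Sum>b\<in>{0<..a}. excess P (p + q) b k) < 0" by (simp add: P_def)
  moreover have "(\<Sum>b\<in>{0<..a}. excess P (p + q) b k) = int (card B) - int (card A)"
    by (simp add: excess_def sum_subtractf A_def B_def)
  ultimately have "card B < card A" by simp
  \<comment> \<open>Beyond the last position both letters of every pair have been placed and each
    excess is 0, so a negative sum bounds \<open>k\<close>.\<close>
  have k: "k \<le> p + q"
  proof (rule ccontr)
    assume "\<not> k \<le> p + q"
    then have "P i < k" if "i \<in> {1..p + q}" for i using P_in[of i] that by auto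
    then have "excess P (p + q) b k = 0" if "b \<in> {0<..a}" for b
    proof -
      have "b \<in> {1..p + q}" "p + q + 1 - b \<in> {1..p + q}" using that a q_le_p by auto
      then show ?thesis using \<open>\<And>i. i \<in> {1..p + q} \<Longrightarrow> P i < k\<close> by (simp add: excess_def)
    qed
    then show False using neg by simp
  qed
  have inv: "invertible g" using g by (intro SLn_invertible) (simp add: iwasawa_borel_def)
  let ?V = "vec.span ((\<lambda>t. g *v u t) ` A)"
  have "A \<subseteq> {1..p + q}" using a q_le_p by (auto simp: A_def)
  then have "vec.dim ?V = card A" by (simp add: dim_image_u inv)
  then have "card B < vec.dim ?V" using \<open>card B < card A\<close> by simp
  moreover have "finite B" by (simp add: B_def)
  ultimately obtain x where x: "x \<in> ?V" "x \<noteq> 0" "\<And>b. b \<in> B \<Longrightarrow> herm x (g *v u (p + q + 1 - b)) = 0"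
    using kernel_vector[OF _ vec.subspace_span, of B _ "\<lambda>b. g *v u (p + q + 1 - b)"] by metis
  \<comment> \<open>The letters before position \<open>k\<close> are
    \<open>w 1, ..., w (k - 1)\<close>, hence the index \<open>k - 1\<close>.\<close>
  let ?F = "act g (flag_of_basis (u \<circ> w)) (k - 1)"
  have F_eq: "?F = vec.span ((\<lambda>i. g *v u (w i)) ` {1..k - 1})"
    unfolding act_flag_of_basis by (simp add: flag_of_basis_def)
  have "?V \<subseteq> ?F"
    unfolding F_eq
  proof (rule vec.span_mono, clarify)
    fix b assume "b \<in> A"
    then have "P b \<in> {1..k - 1}" using P_in[of b] a q_le_p by (auto simp: A_def)
    then show "g *v u b \<in> (\<lambda>i. g *v u (w i)) ` {1..k - 1}"
      by (intro image_eqI[of _ _ "P b"]) (simp_all only: wP)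
  qed
  then have "x \<in> ?F" using x(1) by blast
  have "A \<subseteq> {1..a}" by (auto simp: A_def)
  then have "(\<lambda>x. g *v x) ` vec.span (u ` A) \<subseteq> (\<lambda>x. g *v x) ` vec.span (u ` {1..a})"
    by (intro image_mono vec.span_mono) auto
  moreover have "?V = (\<lambda>x. g *v x) ` vec.span (u ` A)"
    by (simp add: image_image flip: span_matrix_image)
  ultimately have xE: "x \<in> vec.span (u ` {1..a})"
    using x(1) unfolding borel_span[OF g] by blast
  have orth: "herm x y = 0" if "y \<in> vec.span (u ` {1..p + q - a})" for y
  proof -
    have "herm y' x = 0" if "y' \<in> u ` {1..p + q - a}" for y'
    proof (rule herm_span_eq_0[OF _ xE])
      fix y assume "y \<in> u ` {1..a}"
      then have "herm y y' = 0" using that herm_u_u[OF _ _ a] by auto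
      then show "herm y' y = 0" by (simp only: herm_eq_0_commute[of y' y])
    qed
    then show ?thesis by (intro herm_span_eq_0[OF _ that]) (simp only: herm_eq_0_commute[of x])
  qed
  have "herm x y = 0" if "y \<in> ?F" for y
  proof (rule herm_span_eq_0[OF _ that[unfolded F_eq]], clarify)
    fix i assume i: "i \<in> {1..k - 1}"
    then have wi: "w i \<in> {1..p + q}" using k permutes_in_image[OF w, of i] by auto
    show "herm x (g *v u (w i)) = 0"
    proof (cases "w i \<le> p + q - a")
      case True
      then have "u (w i) \<in> vec.span (u ` {1..p + q - a})" using wi by (intro vec.span_base) auto
      then have "g *v u (w i) \<in> vec.span (u ` {1..p + q - a})" using borel_span[OF g] by blast
      then show ?thesis by (rule orth)
    next
      case False
      define b where "b = p + q + 1 - w i"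
      have "w i = p + q + 1 - b" "b \<in> {0<..a}" using False wi by (auto simp: b_def)
      moreover have "P (w i) < k" using i wP by auto
      ultimately have "b \<in> B" by (simp add: B_def)
      from x(3)[OF this] show ?thesis using \<open>w i = p + q + 1 - b\<close> by simp
    qed
  qed
  then have "x = 0" using nd[of "k - 1"] \<open>x \<in> ?F\<close> unfolding nondegenerate_def by blast
  then show False using x(2) by simp
qed

end

section \<open>Flags in open orbits are nondegenerate\<close>

lemma continuous_on_det [continuous_intros]:
  fixes f :: "'a::topological_space \<Rightarrow> complex^'n^'n"
  shows "continuous_on S f \<Longrightarrow> continuous_on S (\<lambda>x. det (f x))"
  unfolding det_def by (intro continuous_intros)

lemma complete_flags_UNIV:
  fixes F :: "nat \<Rightarrow> (complex^'n) set"
  assumes F: "F \<in> complete_flags" and k: "CARD('n) \<le> k"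
  shows "F k = UNIV"
proof (rule vec.subspace_dim_equal)
  have "vec.dim (F k) = CARD('n)" using k complete_flags_dim[OF F, of k] by simp
  then show "vec.dim (UNIV :: (complex^'n) set) \<le> vec.dim (F k)" unfolding vec_dim_card by simp
qed (rule complete_flags_subspace[OF F] vec.subspace_UNIV subset_UNIV)+

lemma det_cnj: "det (\<chi> i j. cnj (A $ i $ j)) = cnj (det A)" for A :: "complex^'n^'n"
  unfolding det_def by simp

text \<open>The determinant tends to 1, where the principal logarithm is continuous.\<close>

lemma sl_scale_tendsto_one:
  fixes G :: "real \<Rightarrow> complex^'n^'n"
  assumes "(G \<longlongrightarrow> mat 1) (at 0)"
  shows "((\<lambda>t. mat (sl_scale (G t)) ** G t) \<longlongrightarrow> mat 1) (at 0)"
proof -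
  have "continuous_on UNIV (\<lambda>A :: complex^'n^'n. det A)" by (intro continuous_intros)
  then have "isCont (\<lambda>A :: complex^'n^'n. det A) (mat 1)" by (simp add: continuous_on_eq_continuous_at)
  then have "((\<lambda>t. det (G t)) \<longlongrightarrow> 1) (at 0)"
    using isCont_tendsto_compose assms by (metis det_I)
  then have "((\<lambda>t. - Ln (det (G t)) / of_nat CARD('n)) \<longlongrightarrow> - Ln 1 / of_nat CARD('n)) (at 0)"
    by (intro tendsto_intros tendsto_Ln) auto
  then have s: "((\<lambda>t. sl_scale (G t)) \<longlongrightarrow> 1) (at 0)"
    unfolding sl_scale_def using tendsto_exp by fastforce
  have "mat c ** A = (\<chi> i j. c * A $ i $ j)" for c and A :: "complex^'n^'n"
    by (simp add: matrix_matrix_mult_def mat_def vec_eq_iff if_distrib if_distribR cong: if_cong)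
  moreover have "((\<lambda>t. \<chi> i j. sl_scale (G t) * G t $ i $ j) \<longlongrightarrow> (\<chi> i j. 1 * mat 1 $ i $ j)) (at 0)"
    by (intro tendsto_vec_lambda tendsto_mult s tendsto_vec_nth assms)
  moreover have "(\<chi> i j. 1 * mat 1 $ i $ j) = (mat 1 :: complex^'n^'n)" by (simp add: vec_eq_iff)
  ultimately show ?thesis by simp
qed

context indefinite_space
begin

section \<open>Deformations of degenerate flags\<close>

lemma SUpq_mult:
  assumes "s \<in> SUpq p q idx" "t \<in> SUpq p q idx"
  shows "s ** t \<in> SUpq p q idx"
  using assms by (auto simp: SUpq_def SLn_mult simp flip: matrix_vector_mul_assoc)

lemma SUpq_one: "mat 1 \<in> SUpq p q idx"
  by (simp add: SUpq_def SLn_one)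

text \<open>Nondegeneracy of the whole space yields a vector not orthogonal to \<open>z\<close>.
  Removing its projection to the \<open>v j\<close>, which are orthogonal to \<open>z\<close>, and
  then a multiple of the isotropic \<open>z\<close> keeps this pairing.\<close>

lemma isotropic_direction:
  assumes v: "orthogonal_on v {1..m}" and z: "z \<noteq> 0" "herm z z = 0" "\<And>j. j \<in> {1..m} \<Longrightarrow> herm z (v j) = 0"
  obtains y where "herm y y = 0" "herm z y \<noteq> 0" "\<And>j. j \<in> {1..m} \<Longrightarrow> herm y (v j) = 0"
proof -
  obtain a where a: "herm z a \<noteq> 0" using herm_nondegenerate z(1) by blast
  define y0 where "y0 = residual v {1..m} a"
  have y0: "herm y0 (v j) = 0" if "j \<in> {1..m}" for j
    using herm_residual[OF v] that by (simp add: y0_def)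
  have "herm z (a - y0) = 0"
    unfolding y0_def by (rule herm_span_eq_0[OF _ residual_in_span]) (use z(3) in blast)
  then have k: "herm z y0 = herm z a" by (simp add: herm_simps)
  define r where "r = herm y0 y0"
  \<comment> \<open>This \<open>c\<close> makes \<open>c * herm z y0\<close> half of the real number
    \<open>herm y0 y0\<close>, so the two cross terms cancel \<open>herm y0 y0\<close>.\<close>
  define c where "c = r / (2 * herm z y0)"
  have r: "cnj r = r" by (simp add: r_def cnj_herm)
  have ck: "c * herm z y0 = r / 2" using a k by (simp add: c_def)
  then have ck': "cnj c * herm y0 z = r / 2" using r by (metis cnj_herm complex_cnj_mult complex_cnj_divide complex_cnj_numeral)
  have "herm (y0 - c *s z) (y0 - c *s z) = r - c * herm z y0 - (cnj c * herm y0 z - cnj c * (c * herm z z))"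
    by (simp add: herm_simps r_def algebra_simps)
  also have "\<dots> = 0" unfolding ck ck' z(2) by simp
  finally have "herm (y0 - c *s z) (y0 - c *s z) = 0" .
  moreover have "herm z (y0 - c *s z) \<noteq> 0" using z(2) a k by (simp add: herm_simps)
  moreover have "herm (y0 - c *s z) (v j) = 0" if "j \<in> {1..m}" for j
    using y0 z(3) that by (simp add: herm_simps)
  ultimately show thesis by (rule that)
qed

text \<open>For isotropic \<open>y\<close> the map \<open>G t\<close> changes the form on
  \<open>x\<close> and \<open>x'\<close> by \<open>2 * t * herm x y * herm y x'\<close>, so in
  general it leaves the isometries while staying near the identity for small
  \<open>t\<close>.\<close>

lemma transvection_path:
  fixes y :: "complex^'n"
  obtains G :: "real \<Rightarrow> complex^'n^'n"
  where "\<And>t x. G t *v x = x + (of_real t * herm x y) *s y" "(G \<longlongrightarrow> mat 1) (at 0)"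
proof -
  define R where "R = matrix (\<lambda>x. herm x y *s y)"
  have R: "R *v x = herm x y *s y" for x unfolding R_def by (rule matrix_works[OF linear_herm])
  define G where "G t = mat 1 + (\<chi> i j. of_real t * R $ i $ j)" for t :: real
  have "(\<chi> i j. of_real t * R $ i $ j) *v x = of_real t *s (R *v x)" for t x
    by (simp add: matrix_vector_mult_def vec_eq_iff sum_distrib_left mult_ac)
  then have "G t *v x = x + (of_real t * herm x y) *s y" for t x
    by (simp add: G_def matrix_vector_mult_add_rdistrib R vec_eq_iff mult_ac)
  moreover have "(G \<longlongrightarrow> mat 1 + (\<chi> i j. of_real 0 * R $ i $ j)) (at 0)"
    unfolding G_def by (intro tendsto_intros tendsto_vec_lambda)
  then have "(G \<longlongrightarrow> mat 1) (at 0)" by (simp add: zero_vec_def[symmetric])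
  ultimately show thesis by (rule that)
qed

text \<open>If \<open>F k\<close> is the first degenerate subspace of \<open>F\<close>, with isotropic vector \<open>z\<close> orthogonal to it,
  then adding to \<open>z\<close> a small multiple of an isotropic \<open>y\<close> orthogonal to \<open>F (k - 1)\<close> makes it nondegenerate,
  whereas the subspaces of all flags in the orbit of \<open>F\<close> have the same radicals up to isometry.\<close>

lemma nondegenerate_if_openin_orbit:
  assumes F: "F \<in> complete_flags" and op: "openin flag_topology (orbit_of (SUpq p q idx) F)"
  shows "nondegenerate (F k)"
proof (rule ccontr)
  assume "\<not> nondegenerate (F k)"
  then obtain k where nd_k: "\<not> nondegenerate (F k)" and nd: "\<And>j. j < k \<Longrightarrow> nondegenerate (F j)"
    using exists_least_iff[of "\<lambda>k. \<not> nondegenerate (F k)"] by blast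
  have "nondegenerate (F 0)"
    using complete_flags_dim[OF F, of 0] by (auto simp: nondegenerate_def vec.dim_eq_0)
  then obtain m where m: "k = Suc m" using nd_k by (cases k) auto
  have "k < p + q"
  proof (rule ccontr)
    assume "\<not> k < p + q"
    then have "F k = UNIV" by (intro complete_flags_UNIV[OF F]) (simp add: card_n)
    then show False using nd_k herm_nondegenerate by (auto simp: nondegenerate_def)
  qed
  obtain v where v: "orthogonal_on v {1..m}" "F m = vec.span (v ` {1..m})"
    using orthogonal_basis_of_flag[OF F, of m] nd m \<open>k < p + q\<close> by auto
  from orthogonal_step[OF F _ v] obtain z where z: "F k = vec.span (insert z (v ` {1..m}))" "z \<notin> F m"
    "\<And>f. f \<in> F m \<Longrightarrow> herm z f = 0" using m \<open>k < p + q\<close> by auto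
  have sub: "vec.subspace (F i)" for i by (rule complete_flags_subspace[OF F])
  have z0: "z \<noteq> 0" using z(2) vec.subspace_0[OF sub] by auto
  have vF: "v j \<in> F m" if "j \<in> {1..m}" for j using that by (auto simp: v(2) intro: vec.span_base)
  have zF: "z \<in> F k" unfolding z(1) by (auto intro: vec.span_base)
  have Fk: "\<exists>c f. x = c *s z + f \<and> f \<in> F m" if "x \<in> F k" for x
  proof -
    obtain c where "x - c *s z \<in> F m" using \<open>x \<in> F k\<close> unfolding z(1) v(2) vec.span_insert by blast
    then show ?thesis by (intro exI[of _ c] exI[of _ "x - c *s z"]) simp
  qed
  have zz: "herm z z = 0"
  proof (rule ccontr)
    assume zz: "herm z z \<noteq> 0"
    have "nondegenerate (F k)"
      unfolding nondegenerate_def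
    proof (intro ballI impI)
      fix x assume x: "x \<in> F k" "\<forall>y\<in>F k. herm x y = 0"
      obtain c f where cf: "x = c *s z + f" "f \<in> F m" using Fk[OF x(1)] by blast
      have "herm f z = 0" using z(3)[OF cf(2)] by (simp only: herm_eq_0_commute[of f z])
      then have "c = 0" using x(2) zF zz by (auto simp: cf(1) herm_simps)
      then have "x \<in> F m" using cf by simp
      moreover have "\<forall>y\<in>F m. herm x y = 0" using x(2) complete_flags_mono[OF F, of m k] m by auto
      ultimately show "x = 0" using nd[of m] m by (auto simp: nondegenerate_def)
    qed
    then show False using nd_k by blast
  qed
  obtain y where y: "herm y y = 0" "herm z y \<noteq> 0" "\<And>j. j \<in> {1..m} \<Longrightarrow> herm y (v j) = 0"
    using isotropic_direction[OF v(1) z0 zz] z(3)[OF vF] by blast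
  have yF: "herm y f = 0" "herm f y = 0" if "f \<in> F m" for f
  proof -
    show "herm y f = 0" using y(3) by (intro herm_span_eq_0[OF _ that[unfolded v(2)]]) auto
    then show "herm f y = 0" by (simp only: herm_eq_0_commute[of f y])
  qed
  obtain G :: "real \<Rightarrow> complex^'n^'n" where G: "\<And>t x. G t *v x = x + (of_real t * herm x y) *s y" and G_lim: "(G \<longlongrightarrow> mat 1) (at 0)"
    using transvection_path[of y] by metis
  let ?T = "{g \<in> SLn. act g F \<in> orbit_of (SUpq p q idx) F}"
  have "openin (top_of_set SLn) ?T" using op F by (simp add: openin_flag_topology)
  then obtain U where U: "open U" "?T = SLn \<inter> U" by (auto simp: openin_open)
  have "mat 1 \<in> ?T" using SLn_one SUpq_one by (auto simp: orbit_of_def)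
  then have "mat 1 \<in> U" using U(2) by blast
  have "eventually (\<lambda>t. mat (sl_scale (G t)) ** G t \<in> U) (at 0)"
    by (rule topological_tendstoD[OF sl_scale_tendsto_one[OF G_lim] U(1) \<open>mat 1 \<in> U\<close>])
  moreover have "eventually (\<lambda>t. det (G t) \<noteq> 0) (at 0)"
  proof -
    have "continuous_on UNIV (\<lambda>A :: complex^'n^'n. det A)" by (intro continuous_intros)
    then have "isCont (\<lambda>A :: complex^'n^'n. det A) (mat 1)" by (simp add: continuous_on_eq_continuous_at)
    then have "((\<lambda>t. det (G t)) \<longlongrightarrow> 1) (at 0)"
      using isCont_tendsto_compose G_lim by (metis det_I)
    then show ?thesis by (rule tendsto_imp_eventually_ne) simp
  qed
  moreover have "eventually (\<lambda>t::real. t \<noteq> 0) (at 0)" by (rule eventually_neq_at_within)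
  ultimately have "eventually (\<lambda>t. mat (sl_scale (G t)) ** G t \<in> U \<and> det (G t) \<noteq> 0 \<and> t \<noteq> 0) (at 0)"
    by eventually_elim simp
  \<comment> \<open>For some nonzero \<open>t\<close> the rescaled \<open>G t\<close> is close
    enough to the identity to move \<open>F\<close> within its orbit.\<close>
  then obtain t where t: "mat (sl_scale (G t)) ** G t \<in> U" "det (G t) \<noteq> 0" "t \<noteq> 0"
    using eventually_happens[of _ "at (0::real)"] by (auto simp: trivial_limit_at)
  have "mat (sl_scale (G t)) ** G t \<in> ?T" using t(1) sl_scale(2)[OF t(2)] U(2) by blast
  moreover have "act (mat (sl_scale (G t)) ** G t) F = act (G t) F"
    by (rule act_scale[OF sl_scale(1)[OF t(2)] sub])
  ultimately obtain s where s: "s \<in> SUpq p q idx" "act (G t) F = act s F"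
    by (auto simp: orbit_of_def)
  have s_iso: "herm (s *v a) (s *v b) = herm a b" for a b
    using s(1) by (simp add: SUpq_def)
  \<comment> \<open>The isometry \<open>s\<close> carries the radical vector \<open>z\<close> of
    \<open>F k\<close> into the radical of \<open>act (G t) F k\<close>; the aim is to show that
    this image must be 0.\<close>
  have "s *v z \<in> act (G t) F k" using zF unfolding s(2) by (auto simp: act_def)
  then obtain x where x: "x \<in> F k" "s *v z = G t *v x" by (auto simp: act_def)
  have rad: "herm (G t *v x) (G t *v f) = 0" if "f \<in> F k" for f
  proof -
    have "G t *v f \<in> act s F k" using that unfolding s(2)[symmetric] by (auto simp: act_def)
    then obtain f' where f': "f' \<in> F k" "G t *v f = s *v f'" by (auto simp: act_def)
    have "herm z f' = 0" using Fk[OF f'(1)] zz z(3) by (auto simp: herm_simps)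
    then show ?thesis by (simp add: f'(2) x(2)[symmetric] s_iso)
  qed
  obtain c f where cf: "x = c *s z + f" "f \<in> F m" using Fk[OF x(1)] by blast
  let ?a = "herm z y"
  have fz: "herm f z = 0" using z(3)[OF cf(2)] by (simp only: herm_eq_0_commute[of f z])
  have Gz: "G t *v z = z + (of_real t * ?a) *s y" by (rule G)
  have Gx: "G t *v x = c *s z + f + (of_real t * (c * ?a)) *s y"
    unfolding G cf(1) by (simp add: herm_simps yF[OF cf(2)])
  \<comment> \<open>The pairing with \<open>G t *v z\<close> leaves \<open>2 * t * c\<close> times
    the squared modulus of \<open>herm z y\<close>, which forces \<open>c = 0\<close>.\<close>
  have "0 = herm (G t *v x) (G t *v z)" using rad[OF zF] by simp
  also have "\<dots> = 2 * of_real t * c * (?a * cnj ?a)"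
    unfolding Gx Gz by (simp add: herm_simps yF[OF cf(2)] zz y(1) fz cnj_herm algebra_simps)
  finally have "c = 0" using t(3) y(2) by auto
  then have "G t *v x = f" using Gx by simp
  \<comment> \<open>What remains is a vector \<open>f\<close> of \<open>F m\<close> orthogonal to
    \<open>F m\<close>, which is nondegenerate by the choice of \<open>k\<close>.\<close>
  have "herm f f' = 0" if "f' \<in> F m" for f'
  proof -
    have "f' \<in> F k" using that complete_flags_mono[OF F, of m k] m by auto
    from rad[OF this] show ?thesis using \<open>G t *v x = f\<close> by (simp add: G yF[OF that])
  qed
  then have "f = 0" using nd[of m] m cf(2) by (auto simp: nondegenerate_def)
  then have "s *v z = 0" using x(2) \<open>G t *v x = f\<close> by simp
  moreover have "inj ((*v) s)"
    using s(1) by (intro inj_matrix_vector_mult SLn_invertible) (simp add: SUpq_def)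
  ultimately show False using z0 by (metis injD matrix_vector_mult_0_right)
qed

end

section \<open>Orbits of coordinate flags are open\<close>

lemma span_insert_diff:
  assumes "y \<in> vec.span S"
  shows "vec.span (insert (x - y) S) = vec.span (insert (x :: complex^'n) S)"
proof -
  have "x - k *s x' \<in> vec.span S \<longleftrightarrow> x - k *s (x' - y) \<in> vec.span S" for x k and x' :: "complex^'n"
  proof -
    have eq: "x - k *s (x' - y) = (x - k *s x') + k *s y" by (simp add: vec_eq_iff algebra_simps)
    show ?thesis
      unfolding eq using vec.span_add_eq2[OF vec.span_scale[OF assms, of k]] by metis
  qed
  then show ?thesis unfolding vec.span_insert by blast
qed

lemma matrix_vector_mult_axis: "(A *v axis k 1) $ r = A $ r $ k" for A :: "complex^'n^'m"
  by (simp add: matrix_vector_mult_def axis_def if_distrib cong: if_cong)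

context indefinite_space
begin

section \<open>Gram-Schmidt process for the indefinite form\<close>

fun gram_schmidt :: "(nat \<Rightarrow> complex^'n) \<Rightarrow> nat \<Rightarrow> complex^'n" where
  "gram_schmidt v k = v k - (\<Sum>j\<in>{1..<k}.
     (herm (v k) (gram_schmidt v j) / herm (gram_schmidt v j) (gram_schmidt v j)) *s gram_schmidt v j)"

declare gram_schmidt.simps [simp del]

lemma gram_schmidt_residual: "gram_schmidt v k = residual (gram_schmidt v) {1..<k} (v k)"
  by (subst gram_schmidt.simps) (simp add: residual_def)

text \<open>Each step subtracts a vector of the span of the previous ones; this holds for any
  coefficients, including quotients that are 0 because their denominator vanishes.\<close>

lemma span_gram_schmidt: "vec.span (gram_schmidt v ` {1..k}) = vec.span (v ` {1..k})"
proof (induction k)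
  case (Suc k)
  have i: "{1..Suc k} = insert (Suc k) {1..k}" "{1..<Suc k} = {1..k}" by auto
  define y where "y = v (Suc k) - gram_schmidt v (Suc k)"
  have y: "y \<in> vec.span (gram_schmidt v ` {1..k})"
    using residual_in_span[of "v (Suc k)" "gram_schmidt v" "{1..k}"]
    unfolding y_def gram_schmidt_residual[of v "Suc k"] i(2) .
  have "gram_schmidt v (Suc k) = v (Suc k) - y" by (simp add: y_def)
  then have "vec.span (gram_schmidt v ` {1..Suc k}) = vec.span (insert (v (Suc k)) (gram_schmidt v ` {1..k}))"
    unfolding i(1) image_insert using span_insert_diff[OF y] by simp
  also have "\<dots> = vec.span (v ` {1..Suc k})"
    unfolding i(1) image_insert vec.span_insert Suc ..
  finally show ?case .
qed simp

lemma orthogonal_on_gram_schmidt: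
  assumes "\<And>k. k \<in> {1..m} \<Longrightarrow> herm (gram_schmidt v k) (gram_schmidt v k) \<noteq> 0"
  shows "orthogonal_on (gram_schmidt v) {1..m}"
  using assms
proof (induction m)
  case (Suc m)
  then have IH: "orthogonal_on (gram_schmidt v) {1..m}" by simp
  have i: "{1..<Suc m} = {1..m}" "{1..Suc m} = insert (Suc m) {1..m}" by auto
  have *: "herm (gram_schmidt v (Suc m)) (gram_schmidt v j) = 0" if "j \<in> {1..m}" for j
    unfolding gram_schmidt_residual[of v "Suc m"] i(1) by (rule herm_residual[OF IH _ that]) simp
  then have "herm (gram_schmidt v j) (gram_schmidt v (Suc m)) = 0" if "j \<in> {1..m}" for j
    using that by (simp add: herm_eq_0_commute[of _ "gram_schmidt v (Suc m)"])
  then show ?case using * IH Suc.prems[of "Suc m"] unfolding i(2) orthogonal_on_def by auto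
qed (simp add: orthogonal_on_def)

lemma tendsto_herm:
  assumes "(f \<longlongrightarrow> a) F" "(g \<longlongrightarrow> b) F"
  shows "((\<lambda>x. herm (f x) (g x)) \<longlongrightarrow> herm a b) F"
  unfolding herm_form_def by (intro tendsto_intros assms)

text \<open>The numerators of the coefficients tend to \<open>herm (v k) (v j) = 0\<close> and the
  denominators to the nonzero \<open>herm (v j) (v j)\<close>, so the correction disappears in the
  limit.\<close>

lemma tendsto_gram_schmidt:
  assumes v: "orthogonal_on v {1..m}" and lim: "\<And>k. k \<in> {1..m} \<Longrightarrow> ((\<lambda>x. f x k) \<longlongrightarrow> v k) F"
    and k: "k \<in> {1..m}"
  shows "((\<lambda>x. gram_schmidt (f x) k) \<longlongrightarrow> v k) F"
  using k
proof (induction k rule: less_induct)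
  case (less k)
  have IH: "((\<lambda>x. gram_schmidt (f x) j) \<longlongrightarrow> v j) F" if "j \<in> {1..<k}" for j
    using less that by auto
  have nz: "herm (v j) (v j) \<noteq> 0" and orth: "herm (v k) (v j) = 0" if "j \<in> {1..<k}" for j
    using v that less.prems by (auto simp: orthogonal_on_def)
  \<comment> \<open>Scalar multiples are written out so that limits can be taken entry by
    entry.\<close>
  have "((\<lambda>x. f x k - (\<Sum>j\<in>{1..<k}. \<chi> i. (herm (f x k) (gram_schmidt (f x) j) / herm (gram_schmidt (f x) j) (gram_schmidt (f x) j)) * gram_schmidt (f x) j $ i))
     \<longlongrightarrow> v k - (\<Sum>j\<in>{1..<k}. \<chi> i. (herm (v k) (v j) / herm (v j) (v j)) * v j $ i)) F"
    by (intro tendsto_diff tendsto_sum tendsto_vec_lambda tendsto_mult tendsto_divide tendsto_herm tendsto_vec_nth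
        IH lim less.prems nz)
  moreover have "(\<Sum>j\<in>{1..<k}. \<chi> i. (herm (v k) (v j) / herm (v j) (v j)) * v j $ i) = 0"
    by (intro sum.neutral) (simp add: orth vec_eq_iff)
  ultimately show ?case
    by (subst gram_schmidt.simps) (simp add: vector_scalar_mult_def)
qed

section \<open>Isometries and their determinants\<close>

lemma vec_eq_sum_e: "x = (\<Sum>i\<in>{1..p + q}. x $ idx i *s e i)"
  unfolding vec_eq_iff
proof
  fix k
  show "x $ k = (\<Sum>i\<in>{1..p + q}. x $ idx i *s e i) $ k"
  proof -
    obtain j where j: "j \<in> {1..p + q}" "k = idx j"
      using bij_betw_imp_surj_on[OF bij_idx] by blast
    have "(\<Sum>i\<in>{1..p + q}. x $ idx i *s e i) $ k = (\<Sum>i\<in>{1..p + q}. if i = j then x $ idx j else 0)"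
      unfolding sum_component j(2) by (rule sum.cong) (use j(1) in \<open>auto simp: e_nth\<close>)
    then show ?thesis using j by simp
  qed
qed

lemma ex_matrix_e:
  obtains S :: "complex^'n^'n" where "\<And>j. j \<in> {1..p + q} \<Longrightarrow> S *v e j = y j"
proof -
  define S where "S = (\<chi> r c. y (the_inv_into {1..p + q} idx c) $ r)"
  have "S *v e j = y j" if "j \<in> {1..p + q}" for j
    using the_inv_into_f_f[OF bij_betw_imp_inj_on[OF bij_idx] that]
    by (simp add: std_basis_def vec_eq_iff matrix_vector_mult_axis S_def)
  then show thesis by (rule that)
qed

lemma isometry_if_on_e:
  assumes S: "\<And>i j. i \<in> {1..p + q} \<Longrightarrow> j \<in> {1..p + q} \<Longrightarrow> herm (S *v e i) (S *v e j) = herm (e i) (e j)"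
  shows "herm (S *v x) (S *v y) = herm x y"
proof -
  have Sx: "S *v x = (\<Sum>i\<in>{1..p + q}. x $ idx i *s (S *v e i))" for x
  proof -
    have "S *v x = S *v (\<Sum>i\<in>{1..p + q}. x $ idx i *s e i)" by (simp only: vec_eq_sum_e[of x, symmetric])
    then show ?thesis
      by (simp only: vec.linear_sum[OF matrix_vector_mul_linear_gen] vector_scalar_commute)
  qed
  have 1: "herm (S *v x) (S *v e j) = herm x (e j)" if "j \<in> {1..p + q}" for x j
  proof -
    have "herm (S *v x) (S *v e j) = (\<Sum>i\<in>{1..p + q}. x $ idx i * herm (e i) (e j))"
      unfolding Sx[of x] herm_sum_left by (rule sum.cong) (use S that in \<open>auto simp: herm_scale_left\<close>)
    also have "\<dots> = herm (\<Sum>i\<in>{1..p + q}. x $ idx i *s e i) (e j)"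
      by (simp only: herm_sum_left herm_scale_left)
    finally show ?thesis by (simp only: vec_eq_sum_e[of x, symmetric])
  qed
  have "herm (S *v y) (S *v x) = (\<Sum>i\<in>{1..p + q}. y $ idx i * herm (S *v e i) (S *v x))"
    unfolding Sx[of y] herm_sum_left herm_scale_left ..
  also have "\<dots> = (\<Sum>i\<in>{1..p + q}. y $ idx i * herm (e i) x)"
    by (rule sum.cong[OF refl]) (metis 1 cnj_herm)
  also have "\<dots> = herm (\<Sum>i\<in>{1..p + q}. y $ idx i *s e i) x"
    by (simp only: herm_sum_left herm_scale_left)
  also have "\<dots> = herm y x" by (simp only: vec_eq_sum_e[of y, symmetric])
  finally show ?thesis by (metis cnj_herm)
qed

text \<open>With \<open>J\<close> the diagonal matrix of signs and \<open>C\<close> the entrywise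
  conjugate of \<open>S\<close>, invariance says \<open>transpose S ** (J ** C) = J\<close>;
  determinants give \<open>det S * cnj (det S) = 1\<close>.\<close>

lemma norm_det_isometry:
  fixes S :: "complex^'n^'n"
  assumes S: "\<And>x y. herm (S *v x) (S *v y) = herm x y"
  shows "norm (det S) = 1"
proof -
  define \<sigma> where "\<sigma> r = sig (the_inv_into {1..p + q} idx r)" for r
  have herm: "herm x y = (\<Sum>r\<in>UNIV. \<sigma> r * (x $ r * cnj (y $ r)))" for x y
  proof -
    have "\<sigma> (idx i) = sig i" if "i \<in> {1..p + q}" for i
      using the_inv_into_f_f[OF bij_betw_imp_inj_on[OF bij_idx] that] by (simp add: \<sigma>_def)
    then have "herm x y = (\<Sum>i\<in>{1..p + q}. \<sigma> (idx i) * (x $ idx i * cnj (y $ idx i)))"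
      unfolding herm_eq by (intro sum.cong) auto
    then show ?thesis
      by (simp only: sum.reindex_bij_betw[OF bij_idx, of "\<lambda>r. \<sigma> r * (x $ r * cnj (y $ r))"])
  qed
  define J :: "complex^'n^'n" where "J = (\<chi> a b. if a = b then \<sigma> a else 0)"
  define C :: "complex^'n^'n" where "C = (\<chi> i j. cnj (S $ i $ j))"
  have JC: "(J ** C) $ a $ b = \<sigma> a * C $ a $ b" for a b
    by (simp add: matrix_matrix_mult_def J_def if_distrib if_distribR cong: if_cong)
  have "(transpose S ** (J ** C)) $ a $ b = J $ a $ b" for a b
  proof -
    have "(transpose S ** (J ** C)) $ a $ b = (\<Sum>r\<in>UNIV. S $ r $ a * (J ** C) $ r $ b)"
      unfolding matrix_matrix_mult_def[of "transpose S" "J ** C"] by (simp add: transpose_def)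
    also have "\<dots> = (\<Sum>r\<in>UNIV. \<sigma> r * (S $ r $ a * cnj (S $ r $ b)))"
      unfolding JC by (simp add: C_def mult_ac)
    also have "\<dots> = herm (S *v axis a 1) (S *v axis b 1)"
      by (simp only: herm matrix_vector_mult_axis)
    also have "\<dots> = herm (axis a 1) (axis b 1)" by (rule S)
    also have "\<dots> = J $ a $ b"
    proof -
      have "herm (axis a 1) (axis b 1) = (\<Sum>r\<in>UNIV. if r = a then J $ a $ b else 0)"
        unfolding herm by (rule sum.cong) (auto simp: axis_def J_def)
      then show ?thesis by simp
    qed
    finally show ?thesis .
  qed
  then have "transpose S ** (J ** C) = J" unfolding vec_eq_iff by blast
  from arg_cong[OF this, of det] have "det S * (det J * cnj (det S)) = det J"
    by (simp add: det_mul det_transpose C_def det_cnj)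
  moreover have "det J = (\<Prod>a\<in>UNIV. \<sigma> a)"
    by (subst det_diagonal) (simp_all add: J_def)
  then have "det J \<noteq> 0" by (simp add: \<sigma>_def)
  ultimately have "det S * cnj (det S) = 1" by (simp add: mult_ac)
  then have "of_real ((norm (det S))\<^sup>2) = (1 :: complex)" by (simp only: complex_norm_square)
  then have "(norm (det S))\<^sup>2 = 1" by (simp only: of_real_eq_1_iff)
  then show ?thesis by (simp add: power2_eq_1_iff) (metis norm_ge_zero not_one_le_zero neg_0_le_iff_le)
qed

text \<open>Since the determinant has modulus 1, so has the scalar that normalises it, and
  multiplication by such a scalar preserves the form.\<close>

lemma SUpq_of_isometry:
  fixes S :: "complex^'n^'n"
  assumes S: "\<And>x y. herm (S *v x) (S *v y) = herm x y"
  shows "det S \<noteq> 0" "mat (sl_scale S) ** S \<in> SUpq p q idx"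
proof -
  have n1: "norm (det S) = 1" by (rule norm_det_isometry[OF S])
  then show d: "det S \<noteq> 0" by auto
  have "norm (sl_scale S) = 1"
    using n1 d by (simp add: sl_scale_def norm_exp_eq_Re)
  then have "sl_scale S * cnj (sl_scale S) = 1"
    by (metis complex_norm_square of_real_1 one_power2)
  moreover have "herm (sl_scale S *s x) (sl_scale S *s y) = (sl_scale S * cnj (sl_scale S)) * herm x y" for x y
    by (simp add: herm_scale_left herm_scale_right)
  ultimately have "herm (sl_scale S *s x) (sl_scale S *s y) = herm x y" for x y by simp
  then show "mat (sl_scale S) ** S \<in> SUpq p q idx"
    using sl_scale(2)[OF d] S
    by (simp add: SUpq_def mat_vector_mult flip: matrix_vector_mul_assoc)
qed

text \<open>If Gram-Schmidt on the moved basis meets the same signs as the original one, normalising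
  yields a basis with the same Gram matrix. The linear map between the two bases is an isometry with
  the same effect on the flag as \<open>g\<close>.\<close>

lemma coordinate_flag_same_signature:
  fixes g :: "complex^'n^'n"
  assumes \<tau>: "\<tau> permutes {1..p + q}" and F0: "flag_of_basis (e \<circ> \<tau>) \<in> complete_flags" and g: "g \<in> SLn"
    and pos: "\<And>k. k \<in> {1..p + q} \<Longrightarrow>
       0 < Re (sig (\<tau> k)) * Re (herm (gram_schmidt (\<lambda>i. g *v e (\<tau> i)) k) (gram_schmidt (\<lambda>i. g *v e (\<tau> i)) k))"
  shows "act g (flag_of_basis (e \<circ> \<tau>)) \<in> orbit_of (SUpq p q idx) (flag_of_basis (e \<circ> \<tau>))"
proof -
  let ?F = "flag_of_basis (e \<circ> \<tau>)"
  define a where "a = gram_schmidt (\<lambda>i. g *v e (\<tau> i))"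
  define r where "r k = sqrt \<bar>Re (herm (a k) (a k))\<bar>" for k
  define x where "x k = of_real (inverse (r k)) *s a k" for k
  have real: "herm y y = of_real (Re (herm y y))" for y
    using cnj_herm[of y y] by (simp add: complex_eq_iff)
  have pos: "0 < Re (sig (\<tau> k)) * Re (herm (a k) (a k))" if "k \<in> {1..p + q}" for k
    using pos[OF that] by (simp add: a_def)
  have r0: "r k > 0" if "k \<in> {1..p + q}" for k using pos[OF that] by (auto simp: r_def)
  have "herm (a k) (a k) \<noteq> 0" if "k \<in> {1..p + q}" for k using pos[OF that] by auto
  then have orth: "orthogonal_on a {1..p + q}"
    unfolding a_def by (rule orthogonal_on_gram_schmidt)
  have xx: "herm (x i) (x j) = (if i = j then sig (\<tau> i) else 0)" if ij: "i \<in> {1..p + q}" "j \<in> {1..p + q}" for i j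
  proof (cases "i = j")
    case True
    have "herm (x i) (x i) = of_real (inverse (r i)) * of_real (inverse (r i)) * of_real (Re (herm (a i) (a i)))"
      unfolding x_def herm_scale_left herm_scale_right by (subst real) simp
    also have "\<dots> = of_real (Re (herm (a i) (a i)) / (r i * r i))"
      by (simp add: field_simps)
    also have "r i * r i = \<bar>Re (herm (a i) (a i))\<bar>" by (simp add: r_def)
    also have "of_real (Re (herm (a i) (a i)) / \<bar>Re (herm (a i) (a i))\<bar>) = sig (\<tau> i)"
      using pos[OF ij(1)] by (auto simp: sig_def split: if_splits)
    finally show ?thesis using True by simp
  next
    case False
    then show ?thesis
      using orth ij by (simp add: x_def herm_scale_left herm_scale_right orthogonal_on_def)
  qed
  \<comment> \<open>This is the required isometry; it sends \<open>e (\<tau> k)\<close> to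
    \<open>x k\<close>.\<close>
  obtain S :: "complex^'n^'n" where S: "\<And>j. j \<in> {1..p + q} \<Longrightarrow> S *v e j = x (inv \<tau> j)"
    using ex_matrix_e[of "\<lambda>j. x (inv \<tau> j)"] by metis
  have \<tau>_in: "\<tau> i \<in> {1..p + q} \<longleftrightarrow> i \<in> {1..p + q}" "inv \<tau> i \<in> {1..p + q} \<longleftrightarrow> i \<in> {1..p + q}" for i
    by (rule permutes_in_image[OF \<tau>], rule permutes_in_image[OF permutes_inv[OF \<tau>]])
  have \<tau>_inv: "inv \<tau> (\<tau> i) = i" "\<tau> (inv \<tau> i) = i" for i using permutes_inverses[OF \<tau>] by simp_all
  have "herm (S *v e i) (S *v e j) = herm (e i) (e j)" if "i \<in> {1..p + q}" "j \<in> {1..p + q}" for i j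
  proof -
    have "inv \<tau> i = inv \<tau> j \<longleftrightarrow> i = j" by (metis \<tau>_inv(2))
    then show ?thesis using that by (simp only: S xx \<tau>_in herm_e_e \<tau>_inv)
  qed
  then have iso: "herm (S *v y) (S *v z) = herm y z" for y z by (rule isometry_if_on_e)
  have sub: "vec.subspace (?F k)" for k by (rule complete_flags_subspace[OF F0])
  have low: "act S ?F k = act g ?F k" if k: "k \<le> p + q" for k
  proof -
    have "act S ?F k = vec.span ((\<lambda>i. S *v e (\<tau> i)) ` {1..k})"
      unfolding act_flag_of_basis by (simp add: flag_of_basis_def)
    also have "(\<lambda>i. S *v e (\<tau> i)) ` {1..k} = x ` {1..k}"
    proof (rule image_cong[OF refl])
      fix i assume "i \<in> {1..k}"
      then have "i \<in> {1..p + q}" using k by auto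
      then show "S *v e (\<tau> i) = x i" by (simp only: S \<tau>_in \<tau>_inv)
    qed
    also have "vec.span (x ` {1..k}) = vec.span (a ` {1..k})"
    proof (rule antisym; rule vec.span_minimal[OF _ vec.subspace_span]; clarify)
      fix i assume i: "i \<in> {1..k}"
      then show "x i \<in> vec.span (a ` {1..k})"
        unfolding x_def by (intro vec.span_scale vec.span_base imageI)
      have "a i = of_real (r i) *s x i" using r0[of i] i k by (simp add: x_def vec_eq_iff)
      moreover have "of_real (r i) *s x i \<in> vec.span (x ` {1..k})"
        using i by (intro vec.span_scale vec.span_base imageI)
      ultimately show "a i \<in> vec.span (x ` {1..k})" by simp
    qed
    also have "\<dots> = vec.span ((\<lambda>i. g *v e (\<tau> i)) ` {1..k})" unfolding a_def by (rule span_gram_schmidt)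
    also have "\<dots> = act g ?F k"
      unfolding act_flag_of_basis by (simp add: flag_of_basis_def)
    finally show ?thesis .
  qed
  have "act S ?F k = act g ?F k" for k
  proof (cases "k \<le> p + q")
    case False
    then have "?F k = ?F (p + q)"
      using complete_flags_UNIV[OF F0] by (simp add: card_n)
    then show ?thesis using low[OF order_refl] by (simp add: act_def)
  qed (rule low)
  then have "act g ?F = act S ?F" by auto
  also have "\<dots> = act (mat (sl_scale S) ** S) ?F"
    by (rule act_scale[OF sl_scale(1)[OF SUpq_of_isometry(1)[OF iso]] sub, symmetric])
  finally show ?thesis using SUpq_of_isometry(2)[OF iso] by (auto simp: orbit_of_def)
qed

text \<open>At the identity the Gram-Schmidt vectors are the coordinate vectors themselves, on which
  the form takes the values \<open>sig (\<tau> k)\<close>. By continuity the signs persist nearby,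
  for the finitely many \<open>k\<close> at once.\<close>

lemma openin_orbit_coordinate_flag:
  assumes \<tau>: "\<tau> permutes {1..p + q}" and F0: "flag_of_basis (e \<circ> \<tau>) \<in> complete_flags"
  shows "openin flag_topology (orbit_of (SUpq p q idx) (flag_of_basis (e \<circ> \<tau>)))"
proof -
  let ?a = "\<lambda>g :: complex^'n^'n. gram_schmidt (\<lambda>i. g *v e (\<tau> i))"
  let ?v = "\<lambda>i. e (\<tau> i)"
  have \<tau>_in: "\<tau> i \<in> {1..p + q} \<longleftrightarrow> i \<in> {1..p + q}" for i by (rule permutes_in_image[OF \<tau>])
  have inj: "\<tau> i = \<tau> j \<longleftrightarrow> i = j" for i j using permutes_inj[OF \<tau>] by (simp add: inj_eq)
  have hv: "herm (?v i) (?v j) = (if i = j then sig (\<tau> i) else 0)"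
    if "i \<in> {1..p + q}" "j \<in> {1..p + q}" for i j
    using that by (simp only: herm_e_e \<tau>_in inj)
  then have orth: "orthogonal_on ?v {1..p + q}" by (auto simp: orthogonal_on_def)
  have lim: "((\<lambda>g :: complex^'n^'n. g *v x) \<longlongrightarrow> x) (nhds (mat 1))" for x
  proof -
    have "continuous_on UNIV (\<lambda>g :: complex^'n^'n. g *v x)" by (intro continuous_intros)
    then have "isCont (\<lambda>g :: complex^'n^'n. g *v x) (mat 1)" by (simp add: continuous_on_eq_continuous_at)
    then show ?thesis
      using tendsto_at_iff_tendsto_nhds[of "\<lambda>g :: complex^'n^'n. g *v x" "mat 1"] by (simp add: isCont_def)
  qed
  have "eventually (\<lambda>g. 0 < Re (sig (\<tau> k)) * Re (herm (?a g k) (?a g k))) (nhds (mat 1))"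
    if k: "k \<in> {1..p + q}" for k
  proof -
    have "((\<lambda>g. ?a g k) \<longlongrightarrow> ?v k) (nhds (mat 1))"
      by (rule tendsto_gram_schmidt[OF orth lim k])
    then have "((\<lambda>g. Re (sig (\<tau> k)) * Re (herm (?a g k) (?a g k))) \<longlongrightarrow> Re (sig (\<tau> k)) * Re (herm (?v k) (?v k))) (nhds (mat 1))"
      by (intro tendsto_intros tendsto_herm)
    moreover have "0 < Re (sig (\<tau> k)) * Re (herm (?v k) (?v k))" by (simp add: hv[OF k k] sig_def)
    ultimately show ?thesis by (rule order_tendstoD(1))
  qed
  then have "eventually (\<lambda>g. \<forall>k\<in>{1..p + q}. 0 < Re (sig (\<tau> k)) * Re (herm (?a g k) (?a g k))) (nhds (mat 1))"
    by (intro eventually_ball_finite) auto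
  then obtain U where U: "open U" "mat 1 \<in> U"
    "\<And>g. g \<in> U \<Longrightarrow> \<forall>k\<in>{1..p + q}. 0 < Re (sig (\<tau> k)) * Re (herm (?a g k) (?a g k))"
    unfolding eventually_nhds by blast
  show ?thesis
  proof (rule openin_orbit_of[OF F0, of _ "SLn \<inter> U"])
    fix g assume "g \<in> SLn \<inter> U"
    then show "act g (flag_of_basis (e \<circ> \<tau>)) \<in> orbit_of (SUpq p q idx) (flag_of_basis (e \<circ> \<tau>))"
      using U(3)[of g] by (intro coordinate_flag_same_signature[OF \<tau> F0]) auto
  qed (use U SLn_one SUpq_mult in \<open>auto simp: SUpq_def openin_open_Int\<close>)
qed

end

section \<open>Iwasawa--Schubert varieties\<close>

context indefinite_space
begin

section \<open>Schubert varieties that meet an open orbit\<close>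

lemma flag_complete: "w permutes {1..p + q} \<Longrightarrow> flag_of_basis (u \<circ> w) \<in> complete_flags"
  by (rule flag_of_iwasawa_basis[OF q_le_p card_n bij_idx])

lemma flag_u_complete: "flag_of_basis u \<in> complete_flags"
  using flag_complete[OF permutes_id] by (simp only: comp_id)

abbreviation borel_orbit :: "(nat \<Rightarrow> nat) \<Rightarrow> (nat \<Rightarrow> (complex^'n) set) set" where
  "borel_orbit w \<equiv> orbit_of (iwasawa_borel p q idx) (flag_of_basis (u \<circ> w))"

lemma borel_orbit_subset:
  assumes "w permutes {1..p + q}"
  shows "borel_orbit w \<subseteq> complete_flags"
  using act_complete_flags[OF _ flag_complete[OF assms]] by (auto simp: orbit_of_def iwasawa_borel_def)

lemma borel_orbit_subset_schubert:
  assumes "w permutes {1..p + q}"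
  shows "borel_orbit w \<subseteq> iwasawa_schubert p q idx w"
  unfolding iwasawa_schubert_def
  by (rule closure_of_subset) (simp add: topspace_flag_topology borel_orbit_subset[OF assms])

text \<open>An open set that meets the closure meets the Borel orbit itself. The common flag is
  isometric to one with open orbit, hence consists of nondegenerate subspaces.\<close>

lemma ballot_if_meets:
  assumes w: "w permutes {1..p + q}" and D: "D \<in> open_SUpq_orbits p q idx"
    and meets: "iwasawa_schubert p q idx w \<inter> D \<noteq> {}" and a: "a \<le> q"
  shows "0 \<le> (\<Sum>b\<in>{0<..a}. excess (inv w) (p + q) b k)"
proof -
  obtain F where F: "F \<in> complete_flags" "D = orbit_of (SUpq p q idx) F" "openin flag_topology D"
    using D by (auto simp: open_SUpq_orbits_def)
  have "D \<inter> borel_orbit w \<noteq> {}"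
    using meets openin_Int_closure_of_eq_empty[OF F(3), of "borel_orbit w"]
    by (auto simp: iwasawa_schubert_def)
  then obtain F' where F': "F' \<in> orbit_of (SUpq p q idx) F" "F' \<in> borel_orbit w"
    unfolding F(2) by blast
  then obtain s where s: "s \<in> SUpq p q idx" "F' = act s F" unfolding orbit_of_def by blast
  obtain g where g: "g \<in> iwasawa_borel p q idx" "F' = act g (flag_of_basis (u \<circ> w))"
    using F'(2) unfolding orbit_of_def by blast
  have iso: "herm (s *v x) (s *v y) = herm x y" for x y using s(1) by (simp add: SUpq_def)
  have "nondegenerate (act s F k)" for k
    using nondegenerate_if_openin_orbit[OF F(1) F(3)[unfolded F(2)], of k]
    unfolding nondegenerate_def act_def by (auto simp: iso)
  then show ?thesis
    using ballot_if_nondegenerate[OF w g(1) _ a] by (simp only: s(2)[symmetric] g(2)[symmetric])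
qed

section \<open>Coordinate flags in Borel orbits\<close>

text \<open>The coordinate flag to be found in the Borel orbit of \<open>w\<close> has
  \<open>e (unfold_index (w k))\<close> as its \<open>k\<close>-th vector: for
  \<open>1 \<le> b \<le> q\<close> the letter \<open>p + q + 1 - b\<close> goes to \<open>b\<close>,
  and \<open>b\<close> goes to its mirror image \<open>2 * q + 1 - b\<close>.\<close>

definition unfold_index :: "nat \<Rightarrow> nat" where
  "unfold_index t = (if t = 0 \<or> p + q < t then t else if t \<le> q then 2 * q + 1 - t
     else if t \<le> p then q + t else p + q + 1 - t)"

lemma unfold_index_permutes: "unfold_index permutes {1..p + q}"
proof (rule bij_imp_permutes)
  show "bij_betw unfold_index {1..p + q} {1..p + q}"
    by (rule bij_betw_byWitness[where f' = "\<lambda>j. if j \<le> q then p + q + 1 - j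
          else if j \<le> 2 * q then 2 * q + 1 - j else j - q"])
       (use q_le_p in \<open>auto simp: unfold_index_def\<close>)
qed (auto simp: unfold_index_def)

lemma ex_matrix_u:
  obtains g :: "complex^'n^'n" where "\<And>t. t \<in> {1..p + q} \<Longrightarrow> g *v u t = z t"
proof -
  obtain f where f: "Vector_Spaces.linear (*s) (*s) f"
    "\<forall>x\<in>u ` {1..p + q}. f x = z (the_inv_into {1..p + q} u x)"
    using vec.linear_independent_extend[OF u_independent(2), of "\<lambda>x. z (the_inv_into {1..p + q} u x)"]
    by blast
  have "matrix f *v u t = z t" if "t \<in> {1..p + q}" for t
    using matrix_works[OF f(1)] f(2) that the_inv_into_f_f[OF u_independent(1) that] by auto
  then show thesis by (rule that)
qed

text \<open>A unipotent change of basis: the late vector \<open>u (p + q + 1 - b)\<close> receives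
  its earlier partner \<open>u b\<close>, which cancels the difference and leaves
  \<open>2 *s e b\<close>.\<close>

definition sheared :: "nat \<Rightarrow> complex^'n" where
  "sheared t = (if t \<le> p then u t else u t + u (p + q + 1 - t))"

text \<open>A vector is only changed by one of smaller index, so the shear stabilises the Iwasawa
  flag.\<close>

lemma span_sheared:
  assumes "k \<le> p + q"
  shows "vec.span (sheared ` {1..k}) = vec.span (u ` {1..k})"
proof (rule antisym; rule vec.span_minimal[OF _ vec.subspace_span]; clarify)
  fix t assume t: "t \<in> {1..k}"
  have low: "p < t \<Longrightarrow> p + q + 1 - t \<in> {1..k} \<and> p + q + 1 - t \<le> p" using t assms q_le_p by auto
  have base: "u s \<in> vec.span (u ` {1..k})" "sheared s \<in> vec.span (sheared ` {1..k})" if "s \<in> {1..k}" for s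
    using that by (auto intro: vec.span_base)
  show "sheared t \<in> vec.span (u ` {1..k})"
    using base(1)[OF t] vec.span_add[OF base(1)[OF t] base(1)] low by (simp add: sheared_def)
  show "u t \<in> vec.span (sheared ` {1..k})"
  proof (cases "t \<le> p")
    case True
    then have "u t = sheared t" by (simp add: sheared_def)
    then show ?thesis using base(2)[OF t] by simp
  next
    case False
    then have "u t = sheared t - sheared (p + q + 1 - t)" using low by (simp add: sheared_def)
    then show ?thesis using vec.span_diff[OF base(2)[OF t] base(2)] low False by simp
  qed
qed

lemma sheared_high:
  assumes "p < t" "t \<le> p + q"
  shows "sheared t = 2 *s e (p + q + 1 - t)"
proof -
  define b where "b = p + q + 1 - t"
  have b: "1 \<le> b" "b \<le> q" "t = p + q + 1 - b" using assms by (auto simp: b_def)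
  show ?thesis
    unfolding sheared_def b_def[symmetric]
    using assms u_high[OF b(1,2)] u_low[OF b(2)] b(3) by (simp add: vec_eq_iff)
qed

text \<open>For a letter \<open>b \<le> q\<close> the vector is
  \<open>e b + e (2 * q + 1 - b)\<close>. The partner of \<open>b\<close> has occurred earlier in
  the word and already contributed \<open>e b\<close>, so \<open>e (2 * q + 1 - b)\<close> is the
  new direction.\<close>

lemma span_sheared_eq_coordinate:
  assumes w: "w permutes {1..p + q}" and nested: "\<And>b. b \<in> {1..q} \<Longrightarrow> inv w (p + q + 1 - b) < inv w b"
    and k: "k \<le> p + q"
  shows "vec.span ((\<lambda>i. sheared (w i)) ` {1..k}) = vec.span ((\<lambda>i. e (unfold_index (w i))) ` {1..k})"
    (is "?S = ?E")
proof -
  have wi: "w i \<in> {1..p + q}" if "i \<in> {1..k}" for i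
    using that k permutes_in_image[OF w, of i] by auto
  have early: "\<exists>i'\<in>{1..k}. w i' = p + q + 1 - w i" if i: "i \<in> {1..k}" and low: "w i \<le> q" for i
  proof -
    have "w i \<in> {1..q}" using wi[OF i] low by auto
    from nested[OF this] have "inv w (p + q + 1 - w i) < i" by (simp add: permutes_inverses[OF w])
    moreover have "inv w (p + q + 1 - w i) \<in> {1..p + q}"
      using permutes_in_image[OF permutes_inv[OF w], of "p + q + 1 - w i"] \<open>w i \<in> {1..q}\<close> q_le_p by auto
    ultimately have "inv w (p + q + 1 - w i) \<in> {1..k}" using i by auto
    then show ?thesis using permutes_inverses(1)[OF w] by blast
  qed
  have high: "sheared (w i) = 2 *s e (unfold_index (w i))" if "i \<in> {1..k}" "p < w i" for i
    using wi[OF that(1)] that(2) sheared_high[of "w i"] q_le_p by (auto simp: unfold_index_def)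
  have mid: "sheared (w i) = e (unfold_index (w i))" if "i \<in> {1..k}" "q < w i" "w i \<le> p" for i
    using that by (auto simp: unfold_index_def sheared_def u_mid)
  have low: "\<exists>i'\<in>{1..k}. p < w i' \<and> sheared (w i) = e (unfold_index (w i')) + e (unfold_index (w i))"
    if i: "i \<in> {1..k}" and wq: "w i \<le> q" for i
  proof -
    obtain i' where i': "i' \<in> {1..k}" "w i' = p + q + 1 - w i" using early[OF i wq] by blast
    then have "p < w i'" "unfold_index (w i') = w i"
      using wi[OF i] wq q_le_p by (auto simp: unfold_index_def)
    moreover have "sheared (w i) = e (w i) + e (unfold_index (w i))"
      using wq wi[OF i] q_le_p by (simp add: sheared_def u_low unfold_index_def)
    ultimately show ?thesis using i'(1) by (intro bexI[of _ i']) simp_all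
  qed
  show ?thesis
  proof (rule antisym; rule vec.span_minimal[OF _ vec.subspace_span]; clarify)
    fix i assume i: "i \<in> {1..k}"
    have eE: "e (unfold_index (w j)) \<in> ?E" if "j \<in> {1..k}" for j using that by (intro vec.span_base) auto
    have sS: "sheared (w j) \<in> ?S" if "j \<in> {1..k}" for j using that by (intro vec.span_base) auto
    have eS: "e (unfold_index (w j)) \<in> ?S" if j: "j \<in> {1..k}" "p < w j" for j
    proof -
      have "(1 / 2) *s sheared (w j) \<in> ?S" by (rule vec.span_scale[OF sS[OF j(1)]])
      then show ?thesis unfolding high[OF j] by simp
    qed
    consider "w i \<le> q" | "q < w i" "w i \<le> p" | "p < w i" by linarith
    then show "sheared (w i) \<in> ?E"
    proof cases
      case 1
      then obtain i' where "i' \<in> {1..k}" "sheared (w i) = e (unfold_index (w i')) + e (unfold_index (w i))"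
        using low[OF i] by blast
      then show ?thesis using vec.span_add[OF eE eE[OF i]] by simp
    next
      case 2
      then show ?thesis using mid[OF i] eE[OF i] by simp
    next
      case 3
      then show ?thesis using high[OF i] vec.span_scale[OF eE[OF i]] by simp
    qed
    consider "w i \<le> q" | "q < w i" "w i \<le> p" | "p < w i" by linarith
    then show "e (unfold_index (w i)) \<in> ?S"
    proof cases
      case 1
      then obtain i' where i': "i' \<in> {1..k}" "p < w i'" "sheared (w i) = e (unfold_index (w i')) + e (unfold_index (w i))"
        using low[OF i] by blast
      then have "e (unfold_index (w i)) = sheared (w i) - e (unfold_index (w i'))" by simp
      then show ?thesis using vec.span_diff[OF sS[OF i] eS[OF i'(1,2)]] by simp
    next
      case 2
      then show ?thesis using mid[OF i] sS[OF i] by simp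
    next
      case 3
      then show ?thesis using eS[OF i] by simp
    qed
  qed
qed

text \<open>The shear, rescaled to determinant 1, lies in the Borel group and carries the flag of
  \<open>u \<circ> w\<close> to the coordinate flag.\<close>

lemma coordinate_flag_in_borel_orbit:
  assumes w: "w permutes {1..p + q}" and nested: "\<And>b. b \<in> {1..q} \<Longrightarrow> inv w (p + q + 1 - b) < inv w b"
  shows "flag_of_basis (e \<circ> (unfold_index \<circ> w)) \<in> borel_orbit w"
proof -
  obtain g0 :: "complex^'n^'n" where g0: "\<And>t. t \<in> {1..p + q} \<Longrightarrow> g0 *v u t = sheared t"
    using ex_matrix_u by metis
  have img: "(\<lambda>x. g0 *v x) ` vec.span (u ` {1..k}) = vec.span (u ` {1..k})" if "k \<le> p + q" for k
  proof -
    have "(\<lambda>x. g0 *v x) ` vec.span (u ` {1..k}) = vec.span ((\<lambda>t. g0 *v u t) ` {1..k})"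
      by (simp only: span_matrix_image[symmetric] image_image)
    also have "(\<lambda>t. g0 *v u t) ` {1..k} = sheared ` {1..k}"
      by (rule image_cong[OF refl], rule g0) (use that in auto)
    finally show ?thesis using span_sheared[OF that] by simp
  qed
  then have "surj ((*v) g0)" using u_independent(3) by (metis order_refl)
  then have "invertible g0" by (metis invertible_right_inverse matrix_right_invertible_surjective)
  then have det: "det g0 \<noteq> 0" by (simp add: invertible_det_nz)
  define g where "g = mat (sl_scale g0) ** g0"
  have act_g: "act g F = act g0 F" if "F \<in> complete_flags" for F
    unfolding g_def by (rule act_scale[OF sl_scale(1)[OF det] complete_flags_subspace[OF that]])
  have "act g0 (flag_of_basis u) k = flag_of_basis u k" for k
  proof (cases "k \<le> p + q")
    case True
    then show ?thesis using img by (simp add: act_def flag_of_basis_def)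
  next
    case False
    then have "flag_of_basis u k = UNIV"
      by (intro complete_flags_UNIV[OF flag_u_complete]) (simp add: card_n)
    then show ?thesis using \<open>surj ((*v) g0)\<close> by (simp add: act_def)
  qed
  then have "act g (flag_of_basis u) = flag_of_basis u" using act_g[OF flag_u_complete] by auto
  then have borel: "g \<in> iwasawa_borel p q idx"
    using sl_scale(2)[OF det] by (simp add: iwasawa_borel_def g_def)
  let ?F = "act g (flag_of_basis (u \<circ> w))"
  have F: "?F \<in> complete_flags"
    using borel by (intro act_complete_flags flag_complete[OF w]) (simp add: iwasawa_borel_def)
  have low: "?F k = flag_of_basis (e \<circ> (unfold_index \<circ> w)) k" if k: "k \<le> p + q" for k
  proof -
    have "?F k = vec.span ((\<lambda>i. g0 *v u (w i)) ` {1..k})"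
      unfolding act_g[OF flag_complete[OF w]] unfolding act_flag_of_basis by (simp add: flag_of_basis_def)
    also have "(\<lambda>i. g0 *v u (w i)) ` {1..k} = (\<lambda>i. sheared (w i)) ` {1..k}"
    proof (rule image_cong[OF refl], rule g0)
      fix i assume "i \<in> {1..k}"
      then show "w i \<in> {1..p + q}" using k permutes_in_image[OF w, of i] by auto
    qed
    also have "vec.span \<dots> = vec.span ((\<lambda>i. e (unfold_index (w i))) ` {1..k})"
      by (rule span_sheared_eq_coordinate[OF w nested k])
    finally show ?thesis by (simp add: flag_of_basis_def)
  qed
  have "?F k = flag_of_basis (e \<circ> (unfold_index \<circ> w)) k" for k
  proof (cases "k \<le> p + q")
    case False
    have "UNIV = ?F (p + q)" by (rule complete_flags_UNIV[OF F, symmetric]) (simp add: card_n)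
    also have "\<dots> = flag_of_basis (e \<circ> (unfold_index \<circ> w)) (p + q)" by (rule low) simp
    also have "\<dots> \<subseteq> flag_of_basis (e \<circ> (unfold_index \<circ> w)) k"
      unfolding flag_of_basis_def by (intro vec.span_mono image_mono) (use False in auto)
    finally have "flag_of_basis (e \<circ> (unfold_index \<circ> w)) k = UNIV" by blast
    moreover have "?F k = UNIV" by (rule complete_flags_UNIV[OF F]) (use False in \<open>simp add: card_n\<close>)
    ultimately show ?thesis by simp
  qed (rule low)
  then have "flag_of_basis (e \<circ> (unfold_index \<circ> w)) = ?F" by auto
  then show ?thesis using borel unfolding orbit_of_def by blast
qed

lemma meets_if_nested:
  assumes w: "w permutes {1..p + q}" and nested: "\<And>b. b \<in> {1..q} \<Longrightarrow> inv w (p + q + 1 - b) < inv w b"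
  shows "\<exists>D\<in>open_SUpq_orbits p q idx. iwasawa_schubert p q idx w \<inter> D \<noteq> {}"
proof -
  let ?F = "flag_of_basis (e \<circ> (unfold_index \<circ> w))"
  have F: "?F \<in> borel_orbit w" by (rule coordinate_flag_in_borel_orbit[OF w nested])
  then have Fc: "?F \<in> complete_flags" using borel_orbit_subset[OF w] by blast
  have "?F \<in> orbit_of (SUpq p q idx) ?F"
    using SUpq_one unfolding orbit_of_def by (auto intro!: exI[of _ "mat 1"] simp: act_one)
  moreover have "?F \<in> iwasawa_schubert p q idx w" using F borel_orbit_subset_schubert[OF w] by blast
  moreover have "orbit_of (SUpq p q idx) ?F \<in> open_SUpq_orbits p q idx"
    using openin_orbit_coordinate_flag[OF permutes_compose[OF w unfold_index_permutes] Fc] Fc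
    unfolding open_SUpq_orbits_def by blast
  ultimately show ?thesis by blast
qed

section \<open>Distinct permutations give distinct varieties\<close>

text \<open>Let \<open>E\<close> be spanned by the \<open>u i\<close> with
  \<open>i \<le> j = w k\<close> that do not occur among \<open>w' 1, ..., w' k\<close>. The flags
  whose \<open>k\<close>-th subspace meets \<open>E\<close> only in 0 form an open set. It contains
  the flag of \<open>w'\<close>, but a dimension count in the span of \<open>u 1, ..., u j\<close>
  shows that it misses the Borel orbit of \<open>w\<close>.\<close>

lemma schubert_separated:
  assumes w: "w permutes {1..p + q}" and w': "w' permutes {1..p + q}" and k: "k \<in> {1..p + q}"
    and eq: "\<And>i. i < k \<Longrightarrow> w i = w' i" and less: "w k < w' k"
  shows "flag_of_basis (u \<circ> w') \<notin> iwasawa_schubert p q idx w"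
proof
  assume mem: "flag_of_basis (u \<circ> w') \<in> iwasawa_schubert p q idx w"
  define j where "j = w k"
  define C where "C = {1..j} - w' ` {1..k}"
  let ?E = "vec.span (u ` C)"
  let ?U = "{F \<in> complete_flags. F k \<inter> ?E = {0}}"
  have i: "{1..k} = insert k {1..<k}" using k by auto
  have prefix: "w ` {1..<k} = w' ` {1..<k}" by (rule image_cong) (auto simp: eq)
  have w_in: "w ` {1..k} \<subseteq> {1..p + q}" "w' ` {1..k} \<subseteq> {1..p + q}"
  proof -
    have "{1..k} \<subseteq> {1..p + q}" using k by auto
    then show "w ` {1..k} \<subseteq> {1..p + q}" "w' ` {1..k} \<subseteq> {1..p + q}"
      using permutes_image[OF w] permutes_image[OF w'] by blast+
  qed
  have j: "j \<in> {1..p + q}" using k permutes_in_image[OF w, of k] by (simp only: j_def)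
  then have C_in: "C \<subseteq> {1..p + q}" by (auto simp: C_def)
  have inv1: "invertible (mat 1 :: complex^'n^'n)" by (rule SLn_invertible[OF SLn_one])
  have dim_u: "vec.dim (u ` A) = card A" if "A \<subseteq> {1..p + q}" for A
    using dim_image_u[OF that inv1] by simp
  have "flag_of_basis (u \<circ> w') k \<inter> ?E = {0}"
  proof -
    let ?W = "w' ` {1..k}"
    have Fk: "flag_of_basis (u \<circ> w') k = vec.span (u ` ?W)"
      by (simp only: flag_of_basis_def image_comp)
    have "?W \<inter> C = {}" by (auto simp: C_def)
    have "{x + y |x y. x \<in> vec.span (u ` ?W) \<and> y \<in> ?E} = vec.span (u ` (?W \<union> C))"
      unfolding image_Un vec.span_Un by auto
    then have "vec.dim (u ` (?W \<union> C)) + vec.dim (vec.span (u ` ?W) \<inter> ?E) = vec.dim (u ` ?W) + vec.dim (u ` C)"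
      using vec.dim_sums_Int[OF vec.subspace_span vec.subspace_span, of "u ` ?W" "u ` C"]
      by (simp only: vec.dim_span)
    moreover have "card (?W \<union> C) = card ?W + card C"
      by (rule card_Un_disjoint[OF _ _ \<open>?W \<inter> C = {}\<close>]) (auto simp: C_def)
    moreover have "?W \<union> C \<subseteq> {1..p + q}" using w_in C_in by blast
    ultimately have "vec.dim (vec.span (u ` ?W) \<inter> ?E) = 0"
      using dim_u[of "?W \<union> C"] dim_u[OF w_in(2)] dim_u[OF C_in] by linarith
    then have "vec.span (u ` ?W) \<inter> ?E \<subseteq> {0}" by (simp only: vec.dim_eq_0)
    then show ?thesis using vec.span_zero[of "u ` ?W"] vec.span_zero[of "u ` C"] unfolding Fk by blast
  qed
  then have "flag_of_basis (u \<circ> w') \<in> ?U" using flag_complete[OF w'] by blast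
  moreover have "openin flag_topology ?U" by (rule openin_transverse_flags[OF vec.subspace_span])
  ultimately have "\<exists>F. F \<in> borel_orbit w \<and> F \<in> ?U"
    using conjunct2[OF mem[unfolded iwasawa_schubert_def in_closure_of], THEN spec, of ?U] by (simp only: simp_thms)
  then obtain F where "F \<in> ?U" "F \<in> borel_orbit w" by (elim exE conjE)
  then obtain g where g: "g \<in> iwasawa_borel p q idx" and trans: "act g (flag_of_basis (u \<circ> w)) k \<inter> ?E = {0}"
    unfolding orbit_of_def mem_Collect_eq by (elim exE conjE) simp
  \<comment> \<open>The vectors \<open>g *v u t\<close> with \<open>t\<close> in \<open>A\<close>
    lie both in the \<open>k\<close>-th subspace and in the span of \<open>u 1, ..., u j\<close>,
    since \<open>g\<close> preserves the latter.\<close>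
  define A where "A = w ` {1..k} \<inter> {1..j}"
  have A_in: "A \<subseteq> {1..p + q}" using j by (auto simp: A_def)
  have ginv: "invertible g" using g by (intro SLn_invertible) (simp add: iwasawa_borel_def)
  let ?V = "vec.span ((\<lambda>t. g *v u t) ` A)"
  have dimV: "vec.dim ?V = card A" using dim_image_u[OF A_in ginv] by (simp only: vec.dim_span)
  have V_act: "?V = (\<lambda>x. g *v x) ` vec.span (u ` A)"
    by (simp only: span_matrix_image[symmetric] image_image)
  have "?V \<subseteq> act g (flag_of_basis (u \<circ> w)) k"
    unfolding V_act act_def flag_of_basis_def image_comp[symmetric]
    by (intro image_mono vec.span_mono) (auto simp: A_def)
  then have VE: "?V \<inter> ?E \<subseteq> {0}" using trans by blast
  have "?V \<subseteq> (\<lambda>x. g *v x) ` vec.span (u ` {1..j})"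
    unfolding V_act by (intro image_mono vec.span_mono) (auto simp: A_def)
  then have Vj: "?V \<subseteq> vec.span (u ` {1..j})" unfolding borel_span[OF g] .
  have Ej: "?E \<subseteq> vec.span (u ` {1..j})" by (intro vec.span_mono image_mono) (auto simp: C_def)
  have "{x + y |x y. x \<in> ?V \<and> y \<in> ?E} \<subseteq> vec.span (u ` {1..j})"
    using Vj Ej by (auto intro!: vec.span_add)
  then have "vec.dim {x + y |x y. x \<in> ?V \<and> y \<in> ?E} \<le> vec.dim (vec.span (u ` {1..j}))" by (rule vec.dim_subset)
  also have "\<dots> = j" using dim_u[of "{1..j}"] j by (simp only: vec.dim_span) auto
  finally have "vec.dim ?V + vec.dim ?E \<le> j"
    using vec.dim_sums_Int[OF vec.subspace_span vec.subspace_span, of "(\<lambda>t. g *v u t) ` A" "u ` C"] VE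
    by (simp only: vec.dim_eq_0[THEN iffD2, OF VE])
  moreover have "vec.dim ?E = card C" using dim_u[OF C_in] by (simp only: vec.dim_span)
  \<comment> \<open>The prefixes before \<open>k\<close> agree. \<open>A\<close> consists of their
    letters up to \<open>j\<close> and of \<open>j\<close> itself, while \<open>C\<close> is the
    complement of the prefix letters in \<open>{1..j}\<close>, because \<open>w' k > j\<close>. This
    is one dimension too many.\<close>
  moreover have "card A + card C = j + 1"
  proof -
    have "w k \<notin> w ` {1..<k}" by (simp add: inj_image_mem_iff[OF permutes_inj[OF w]])
    then have "A = insert j (w ` {1..<k} \<inter> {1..j})" "j \<notin> w ` {1..<k} \<inter> {1..j}"
      using j unfolding A_def i by (auto simp: j_def)
    moreover have "C = {1..j} - (w ` {1..<k} \<inter> {1..j})"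
      using less unfolding C_def i prefix by (auto simp: j_def)
    moreover have "card (w ` {1..<k} \<inter> {1..j}) \<le> card {1..j}" by (rule card_mono) auto
    ultimately show ?thesis by (simp add: card_Diff_subset)
  qed
  ultimately show False using dimV by simp
qed

text \<open>At the first position where the permutations differ, the variety with the smaller letter
  does not contain the base flag of the other one, which lies in its own variety.\<close>

lemma schubert_inj:
  assumes w: "w permutes {1..p + q}" and w': "w' permutes {1..p + q}"
    and eq: "iwasawa_schubert p q idx w = iwasawa_schubert p q idx w'"
  shows "w = w'"
proof (rule ccontr)
  assume "w \<noteq> w'"
  then obtain k where k: "w k \<noteq> w' k" "\<And>i. i < k \<Longrightarrow> w i = w' i"
    using exists_least_iff[of "\<lambda>k. w k \<noteq> w' k"] by blast
  have k_in: "k \<in> {1..p + q}"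
    using k(1) permutes_not_in[OF w, of k] permutes_not_in[OF w', of k] by metis
  have mem: "flag_of_basis (u \<circ> v) \<in> iwasawa_schubert p q idx v" if v: "v permutes {1..p + q}" for v
  proof -
    have "mat 1 \<in> iwasawa_borel p q idx" by (simp add: iwasawa_borel_def SLn_one act_one)
    then have "flag_of_basis (u \<circ> v) \<in> borel_orbit v"
      unfolding orbit_of_def by (auto intro!: exI[of _ "mat 1"] simp: act_one)
    then show ?thesis using borel_orbit_subset_schubert[OF v] by blast
  qed
  consider "w k < w' k" | "w' k < w k" using k(1) by linarith
  then show False
  proof cases
    case 1
    then show ?thesis using schubert_separated[OF w w' k_in k(2)] mem[OF w'] eq by simp
  next
    case 2
    then show ?thesis using schubert_separated[OF w' w k_in k(2)[symmetric]] mem[OF w] eq by simp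
  qed
qed

section \<open>Identification of the set and its cardinality\<close>

lemma I_set_eq: "I_set p q idx = iwasawa_schubert p q idx ` {w. w permutes {1..p + q} \<and> nested_perm (p + q) q w}"
proof -
  have "perm_length (p + q) w = p * q \<and> (\<exists>D\<in>open_SUpq_orbits p q idx. iwasawa_schubert p q idx w \<inter> D \<noteq> {})
      \<longleftrightarrow> nested_perm (p + q) q w" if w: "w permutes {1..p + q}" for w
  proof
    assume *: "perm_length (p + q) w = p * q \<and> (\<exists>D\<in>open_SUpq_orbits p q idx. iwasawa_schubert p q idx w \<inter> D \<noteq> {})"
    then show "nested_perm (p + q) q w"
      using nested_perm_if_minimal[OF w q_le_p] ballot_if_meets[OF w] by blast
  next
    assume n: "nested_perm (p + q) q w"
    then have "\<exists>D\<in>open_SUpq_orbits p q idx. iwasawa_schubert p q idx w \<inter> D \<noteq> {}"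
      by (intro meets_if_nested[OF w]) (simp add: nested_perm_def)
    then show "perm_length (p + q) w = p * q \<and> (\<exists>D\<in>open_SUpq_orbits p q idx. iwasawa_schubert p q idx w \<inter> D \<noteq> {})"
      using perm_length_nested[OF w q_le_p n] by blast
  qed
  then show ?thesis unfolding I_set_def by blast
qed

lemma card_I_set: "card (I_set p q idx) = (\<Prod>i=1..q. p + q + 1 - 2 * i)"
proof -
  have "inj_on (iwasawa_schubert p q idx) {w. w permutes {1..p + q} \<and> nested_perm (p + q) q w}"
    by (rule inj_onI) (use schubert_inj in blast)
  then have "card (I_set p q idx) = card {w. w permutes {1..p + q} \<and> nested_perm (p + q) q w}"
    unfolding I_set_eq by (rule card_image)
  also have "\<dots> = (\<Prod>i=1..q. p + q + 1 - 2 * i)"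
    by (rule card_nested_perm) (use q_le_p in simp)
  finally show ?thesis .
qed

end

theorem corollary40:
  fixes p q :: nat and idx :: "nat \<Rightarrow> 'n::finite"
  assumes "p \<ge> q" and "q \<ge> 1"
    and "CARD('n) = p + q"
    and "bij_betw idx {1..p + q} UNIV"
  shows "card (I_set p q idx) = (\<Prod>i=1..q. p + q + 1 - 2 * i)"
proof -
  interpret indefinite_space p q idx
    by unfold_locales (use assms in auto)
  show ?thesis by (rule card_I_set)
qed

end
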